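(* Let $X$ be a separable Banach space. Then a function $\phi:[0,1]\to X$ is McShane integrable if and only if it is Pettis integrable.
   Context: Banach spaces are real; $X^*$ is the dual of $X$. $\mu$ is Lebesgue measure on $[0,1]$ and $\Sigma$ the $\sigma$-algebra of Lebesgue measurable subsets of $[0,1]$. Intervals are non-overlapping if their interiors are pairwise disjoint. McShane integral: A McShane partition of $[0,1]$ is a finite sequence $\langle([a_i,b_i],t_i)\rangle_{i\le n}$ such that $\langle[a_i,b_i]\rangle_{i\le n}$ is a non-overlapping family of closed intervals covering $[0,1]$ (i.e. with union $[0,1]$) and $t_i\in[0,1]$ for each $i$ (it is not required that $t_i\in[a_i,b_i]$). A gauge on $[0,1]$ is a function $\delta:[0,1]\to(0,\infty)$. The partition is subordinate to $\delta$ if $t_i-\delta(t_i)\le a_i\le b_i\le t_i+\delta(t_i)$ for every $i\le n$. A function $\phi:[0,1]\to X$ is McShane integrable, with McShane integral $w\in X$, if for every $\epsilon>0$ there is a gauge $\delta$ such that $\|w-\sum_{i\le n}(b_i-a_i)\phi(t_i)\|\le\epsilon$ for every McShane partition $\langle([a_i,b_i],t_i)\rangle_{i\le n}$ of $[0,1]$ subordinate to $\delta$. Pettis integral: $\phi:[0,1]\to X$ is Pettis integrable if for every $E\in\Sigma$ there is $w_E\in X$ such that for every $f\in X^*$ the integral $\int_E f(\phi(x))\,\mu(dx)$ exists and equals $f(w_E)$. *)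

theory Defs
  imports "HOL-Analysis.Analysis"
begin

text \<open>
  A function on the unit interval is a total function on the reals of which only the values
  on \<open>{0..1}\<close> enter the definitions. A finite sequence of length \<open>n\<close> is a function on the
  naturals of which only the values below \<open>n\<close> enter.
\<close>

definition mcshane_partition ::
    "nat \<Rightarrow> (nat \<Rightarrow> real) \<Rightarrow> (nat \<Rightarrow> real) \<Rightarrow> (nat \<Rightarrow> real) \<Rightarrow> bool" where
  "mcshane_partition n a b t \<longleftrightarrow>
     (\<forall>i<n. a i \<le> b i) \<and>
     (\<forall>i<n. \<forall>j<n. i \<noteq> j \<longrightarrow> interior {a i..b i} \<inter> interior {a j..b j} = {}) \<and>
     (\<Union>i<n. {a i..b i}) = {0..1} \<and>
     (\<forall>i<n. t i \<in> {0..1})"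

text \<open>
  The library's \<open>gauge\<close> and \<open>fine\<close> use neighbourhood-valued gauges on the whole space;
  here a gauge is a positive function on \<open>{0..1}\<close>.
\<close>

definition mcshane_gauge :: "(real \<Rightarrow> real) \<Rightarrow> bool" where
  "mcshane_gauge \<delta> \<longleftrightarrow> (\<forall>x\<in>{0..1}. 0 < \<delta> x)"

definition mcshane_subordinate ::
    "(real \<Rightarrow> real) \<Rightarrow> nat \<Rightarrow> (nat \<Rightarrow> real) \<Rightarrow> (nat \<Rightarrow> real) \<Rightarrow> (nat \<Rightarrow> real) \<Rightarrow> bool" where
  "mcshane_subordinate \<delta> n a b t \<longleftrightarrow>
     (\<forall>i<n. t i - \<delta> (t i) \<le> a i \<and> a i \<le> b i \<and> b i \<le> t i + \<delta> (t i))"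

definition has_mcshane_integral :: "(real \<Rightarrow> 'a::banach) \<Rightarrow> 'a \<Rightarrow> bool" where
  "has_mcshane_integral \<phi> w \<longleftrightarrow>
     (\<forall>\<epsilon>>0. \<exists>\<delta>. mcshane_gauge \<delta> \<and>
        (\<forall>n a b t. mcshane_partition n a b t \<longrightarrow> mcshane_subordinate \<delta> n a b t \<longrightarrow>
           norm (w - (\<Sum>i<n. (b i - a i) *\<^sub>R \<phi> (t i))) \<le> \<epsilon>))"

definition mcshane_integrable :: "(real \<Rightarrow> 'a::banach) \<Rightarrow> bool" where
  "mcshane_integrable \<phi> \<longleftrightarrow> (\<exists>w. has_mcshane_integral \<phi> w)"

definition pettis_integrable :: "(real \<Rightarrow> 'a::banach) \<Rightarrow> bool" where
  "pettis_integrable \<phi> \<longleftrightarrow>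
     (\<forall>E \<in> sets (lebesgue_on {0..1}). \<exists>w. \<forall>f :: 'a \<Rightarrow>\<^sub>L real.
        has_bochner_integral (lebesgue_on E) (\<lambda>x. blinfun_apply f (\<phi> x)) (blinfun_apply f w))"

end

(*
  From McShane to Pettis: by the McShane form of Henstock's lemma, for every partition subordinate to
  a gauge for \<open>\<epsilon>\<close> and every functional f of norm at most 1, the step function of the partition lies
  within \<open>2 * \<epsilon>\<close> of \<open>f \<circ> \<phi>\<close> in L1. Hence the weighted sums of \<open>\<phi> (t i)\<close> with weights
  \<open>measure lebesgue (E \<inter> {a i..b i})\<close> form a Cauchy sequence as \<open>\<epsilon>\<close> tends to 0, and its limit is the
  Pettis integral over E.

  From Pettis to McShane: separability and a Baire category argument make the indefinite integral W
  uniformly small on small sets, and [0,1] splits into measurable sets E k on which \<open>\<phi>\<close> varies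
  by little. A gauge forcing intervals tagged in E k into an open set barely larger than E k then bounds
  the difference of W {0..1} and a Riemann sum by three small terms: the variation of \<open>\<phi>\<close> on the E k,
  W of the union R of the sets by which the intervals leave their E k, and the part of the Riemann sum
  carried by R.
*)
theory Submission
  imports Defs
begin

section \<open>Norming functionals\<close>

text \<open>Hahn-Banach for the line through \<open>x\<^sub>0\<close>. Zorn's lemma runs over
  subspaces of the product \<open>'a \<times> real\<close> lying below the graph of the norm, so
  that no partial functionals appear; a maximal subspace turns out to be the graph of a total
  functional.\<close>

lemma norming_functional:
  fixes x\<^sub>0 :: "'a::real_normed_vector"
  obtains f :: "'a \<Rightarrow>\<^sub>L real" where "norm f \<le> 1" "blinfun_apply f x\<^sub>0 = norm x\<^sub>0"
proof -
  define \<G> where "\<G> = {G :: ('a \<times> real) set. subspace G \<and> (\<forall>(x, r) \<in> G. r \<le> norm x) \<and>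
    (x\<^sub>0, norm x\<^sub>0) \<in> G}"
  have "span {(x\<^sub>0, norm x\<^sub>0)} \<in> \<G>"
  proof -
    have "c * norm x\<^sub>0 \<le> norm (c *\<^sub>R x\<^sub>0)" for c
      by (simp add: mult_right_mono)
    then have "r \<le> norm x" if "(x, r) \<in> span {(x\<^sub>0, norm x\<^sub>0)}" for x r
      using that by (auto simp: span_singleton)
    then show ?thesis
      unfolding \<G>_def by (auto intro: span_base)
  qed
  then have "\<G> \<noteq> {}"
    by blast
  moreover have "\<Union>\<C> \<in> \<G>" if "\<C> \<noteq> {}" "subset.chain \<G> \<C>" for \<C>
  proof -
    have sub: "\<C> \<subseteq> \<G>" and chain: "\<And>A B. A \<in> \<C> \<Longrightarrow> B \<in> \<C> \<Longrightarrow> A \<subseteq> B \<or> B \<subseteq> A"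
      using that(2) by (auto simp: subset.chain_def)
    have "subspace (\<Union>\<C>)"
    proof (rule subspaceI)
      show "0 \<in> \<Union>\<C>"
        using that(1) sub subspace_0 unfolding \<G>_def by blast
      show "c *\<^sub>R u \<in> \<Union>\<C>" if "u \<in> \<Union>\<C>" for c u
        using that sub subspace_scale unfolding \<G>_def by blast
      show "u + v \<in> \<Union>\<C>" if u: "u \<in> \<Union>\<C>" and v: "v \<in> \<Union>\<C>" for u v
      proof -
        obtain A B where AB: "A \<in> \<C>" "u \<in> A" "B \<in> \<C>" "v \<in> B"
          using u v by blast
        then obtain C where "C \<in> \<C>" "u \<in> C" "v \<in> C"
          using chain[of A B] by blast
        then show ?thesis
          using sub subspace_add unfolding \<G>_def by blast
      qed
    qed
    then show ?thesis
      using that(1) sub by (auto simp: \<G>_def)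
  qed
  ultimately obtain G where "G \<in> \<G>" and max: "\<And>H. H \<in> \<G> \<Longrightarrow> G \<subseteq> H \<Longrightarrow> H = G"
    using subset_Zorn_nonempty[of \<G>] by metis
  then have G: "subspace G" "\<And>x r. (x, r) \<in> G \<Longrightarrow> r \<le> norm x" "(x\<^sub>0, norm x\<^sub>0) \<in> G"
    by (auto simp: \<G>_def)
  have Ex: "\<exists>r. (y, r) \<in> G" for y
  proof -
    \<comment> \<open>An admissible value at \<open>y\<close> lies above every
      \<open>r - norm (x - y)\<close> and below every \<open>norm (x + y) - r\<close>. By
      \<open>sep\<close> no lower bound exceeds an upper one, so the supremum of the lower bounds is
      admissible.\<close>
    define a where "a = (SUP (x, r) \<in> G. r - norm (x - y))"
    have sep: "r - norm (x - y) \<le> norm (x' + y) - r'" if "(x, r) \<in> G" "(x', r') \<in> G" for x r x' r'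
    proof -
      have "(x + x', r + r') \<in> G"
        using subspace_add[OF G(1) that] by simp
      then have "r + r' \<le> norm (x + x')"
        by (rule G(2))
      also have "\<dots> \<le> norm (x - y) + norm (x' + y)"
        by (rule order_trans[OF _ norm_triangle_ineq]) simp
      finally show ?thesis
        by simp
    qed
    have bdd: "bdd_above ((\<lambda>(x, r). r - norm (x - y)) ` G)"
      using sep[OF _ G(3)] by (auto intro!: bdd_aboveI2)
    have low: "r - norm (x - y) \<le> a" if "(x, r) \<in> G" for x r
      unfolding a_def using cSUP_upper[OF that bdd] by simp
    have up: "a \<le> norm (x + y) - r" if "(x, r) \<in> G" for x r
      unfolding a_def using G(3) sep[OF _ that] by (intro cSUP_least) auto
    \<comment> \<open>Homogeneity reduces this to \<open>c = 1\<close> and \<open>c = -1\<close>,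
      where it is \<open>up\<close> and \<open>low\<close>.\<close>
    have key: "r + c * a \<le> norm (x + c *\<^sub>R y)" if "(x, r) \<in> G" for x r c
    proof -
      consider "c = 0" | "c > 0" | "c < 0"
        by linarith
      then show ?thesis
      proof cases
        case 1
        then show ?thesis
          using G(2)[OF that] by simp
      next
        case 2
        have "((1 / c) *\<^sub>R x, r / c) \<in> G"
          using subspace_scale[OF G(1) that, of "1 / c"] by simp
        from up[OF this] have "c * a \<le> c * (norm ((1 / c) *\<^sub>R x + y) - r / c)"
          using 2 by (intro mult_left_mono) auto
        also have "\<dots> = norm (c *\<^sub>R ((1 / c) *\<^sub>R x + y)) - r"
          using 2 by (simp add: right_diff_distrib)
        finally show ?thesis
          using 2 by (simp add: scaleR_add_right)
      next
        case 3
        have "((- 1 / c) *\<^sub>R x, - r / c) \<in> G"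
          using subspace_scale[OF G(1) that, of "- 1 / c"] by simp
        from low[OF this] have "(- c) * (- r / c - norm ((- 1 / c) *\<^sub>R x - y)) \<le> (- c) * a"
          using 3 by (intro mult_left_mono) auto
        moreover have "(- c) * (- r / c - norm ((- 1 / c) *\<^sub>R x - y))
            = r - norm ((- c) *\<^sub>R ((- 1 / c) *\<^sub>R x - y))"
          using 3 by (simp add: right_diff_distrib)
        moreover have "(- c) *\<^sub>R ((- 1 / c) *\<^sub>R x - y) = x + c *\<^sub>R y"
          using 3 by (simp add: scaleR_diff_right)
        ultimately have "r - norm (x + c *\<^sub>R y) \<le> (- c) * a"
          by (simp only:)
        then show ?thesis
          by simp
      qed
    qed
    \<comment> \<open>Adjoining \<open>(y, a)\<close> stays below the norm, so by maximality the
      pair already lies in \<open>G\<close>, and the domain of \<open>G\<close> is the whole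
      space.\<close>
    define H where "H = span (insert (y, a) G)"
    have "H \<in> \<G>"
    proof -
      have "r \<le> norm x" if xr: "(x, r) \<in> H" for x r
      proof -
        obtain c where "(x, r) - c *\<^sub>R (y, a) \<in> span G"
          using xr unfolding H_def span_breakdown_eq by blast
        then have "(x - c *\<^sub>R y, r - c * a) \<in> G"
          using G(1) by (simp add: span_eq_iff[THEN iffD2])
        from key[OF this, of c] show ?thesis
          by simp
      qed
      then show ?thesis
        using G(3) by (auto simp: \<G>_def H_def intro: span_base)
    qed
    moreover have "G \<subseteq> H"
      by (auto simp: H_def intro: span_base)
    ultimately have "H = G"
      by (rule max)
    then show ?thesis
      by (auto simp: H_def intro: span_base)
  qed
  \<comment> \<open>Domination alone makes \<open>G\<close> single-valued: \<open>(0, r - s)\<close>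
    and \<open>(0, s - r)\<close> both lie in \<open>G\<close>, so neither second coordinate is
    positive.\<close>
  have single: "r = s" if "(x, r) \<in> G" "(x, s) \<in> G" for x r s
    using G(2)[of 0 "r - s"] G(2)[of 0 "s - r"]
      subspace_diff[OF G(1) that] subspace_diff[OF G(1) that(2,1)] by simp
  define F where "F x = (THE r. (x, r) \<in> G)" for x
  have F: "(x, F x) \<in> G" for x
    unfolding F_def using Ex single by (metis theI)
  have F_eq: "F x = r" if "(x, r) \<in> G" for x r
    using single F that by blast
  have F_le: "\<bar>F x\<bar> \<le> norm x" for x
    using G(2)[OF F[of x]] G(2)[of "- x" "- F x"] subspace_neg[OF G(1) F[of x]] by simp
  have lin: "bounded_linear F"
  proof (rule bounded_linear_intro[where K = 1])
    show "F (x + y) = F x + F y" for x y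
      using subspace_add[OF G(1) F F, of x y] by (intro F_eq) simp
    show "F (c *\<^sub>R x) = c *\<^sub>R F x" for c x
      using subspace_scale[OF G(1) F, of c x] by (intro F_eq) simp
  qed (use F_le in simp)
  show thesis
  proof (rule that)
    show "norm (Blinfun F) \<le> 1"
      by (rule norm_blinfun_bound) (use F_le in \<open>auto simp: bounded_linear_Blinfun_apply[OF lin]\<close>)
    show "blinfun_apply (Blinfun F) x\<^sub>0 = norm x\<^sub>0"
      using F_eq[OF G(3)] by (simp add: bounded_linear_Blinfun_apply[OF lin])
  qed
qed

text \<open>Vectors known only through weak integrals are estimated in norm this way, by scalar
  bounds that are uniform over the dual unit ball.\<close>

lemma norm_le_if_functionals_le:
  fixes x :: "'a::real_normed_vector"
  assumes "\<And>f :: 'a \<Rightarrow>\<^sub>L real. norm f \<le> 1 \<Longrightarrow> \<bar>blinfun_apply f x\<bar> \<le> c"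
  shows "norm x \<le> c"
  using norming_functional[of x] assms by (metis abs_norm_cancel)

lemma blinfun_apply_le_norm:
  fixes f :: "'a::real_normed_vector \<Rightarrow>\<^sub>L real"
  assumes "norm f \<le> 1"
  shows "\<bar>blinfun_apply f x\<bar> \<le> norm x"
  using norm_blinfun[of f x] mult_right_mono[OF assms norm_ge_zero[of x]] by simp

section \<open>McShane partitions\<close>

text \<open>Partitions built below are indexed by pairs or by a sum type and may have empty cells,
  which \<open>mcshane_partition\<close> does not admit. Empty cells have length 0 and are dropped;
  \<open>h\<close> enumerates the others.\<close>

lemma mcshane_bound_indexed:
  fixes \<phi> :: "real \<Rightarrow> 'a::banach"
  assumes bound: "\<And>n a b t. mcshane_partition n a b t \<Longrightarrow> mcshane_subordinate \<delta> n a b t \<Longrightarrow>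
      norm (w - (\<Sum>i<n. (b i - a i) *\<^sub>R \<phi> (t i))) \<le> \<epsilon>"
    and "finite A"
    and interval: "\<And>i. i \<in> A \<Longrightarrow> \<exists>u v. L i = {u..v}"
    and disj: "\<And>i j. i \<in> A \<Longrightarrow> j \<in> A \<Longrightarrow> i \<noteq> j \<Longrightarrow> interior (L i) \<inter> interior (L j) = {}"
    and cover: "(\<Union>i\<in>A. L i) = {0..1}"
    and tag: "\<And>i. i \<in> A \<Longrightarrow> t i \<in> {0..1}"
    and fine: "\<And>i. i \<in> A \<Longrightarrow> L i \<subseteq> {t i - \<delta> (t i)..t i + \<delta> (t i)}"
  shows "norm (w - (\<Sum>i\<in>A. measure lborel (L i) *\<^sub>R \<phi> (t i))) \<le> \<epsilon>"
proof -
  define B where "B = {i \<in> A. L i \<noteq> {}}"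
  have "finite B"
    using \<open>finite A\<close> by (simp add: B_def)
  then obtain h where h: "bij_betw h {..<card B} B"
    using ex_bij_betw_nat_finite by (metis atLeast0LessThan)
  have hB: "h k \<in> B" if "k < card B" for k
    using h that by (auto simp: bij_betw_def)
  define a b where "a k = Inf (L (h k))" and "b k = Sup (L (h k))" for k
  have L: "L (h k) = {a k..b k}" "a k \<le> b k" if k: "k < card B" for k
  proof -
    obtain u v where uv: "L (h k) = {u..v}"
      using interval[of "h k"] hB[OF k] unfolding B_def by blast
    moreover have "L (h k) \<noteq> {}"
      using hB[OF k] by (simp add: B_def)
    ultimately show "L (h k) = {a k..b k}" "a k \<le> b k"
      by (auto simp: a_def b_def)
  qed
  have "mcshane_partition (card B) a b (t \<circ> h)"
    unfolding mcshane_partition_def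
  proof (intro conjI allI impI)
    show "interior {a i..b i} \<inter> interior {a j..b j} = {}"
      if "i < card B" "j < card B" "i \<noteq> j" for i j
    proof -
      have "h i \<noteq> h j"
        using h that by (auto simp: bij_betw_def inj_on_def)
      then show ?thesis
        using disj[of "h i" "h j"] hB[of i] hB[of j] L that by (simp add: B_def)
    qed
    have "(\<Union>k<card B. {a k..b k}) = (\<Union>k<card B. L (h k))"
      using L(1) by simp
    also have "\<dots> = (\<Union>i\<in>B. L i)"
      using h by (metis bij_betw_imp_surj_on image_image)
    also have "\<dots> = {0..1}"
      unfolding cover[symmetric] by (auto simp: B_def)
    finally show "(\<Union>k<card B. {a k..b k}) = {0..1}" .
    show "(t \<circ> h) i \<in> {0..1}" if "i < card B" for i
      using tag hB[OF that] by (auto simp: B_def)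
  qed (use L in auto)
  moreover have "mcshane_subordinate \<delta> (card B) a b (t \<circ> h)"
    unfolding mcshane_subordinate_def
  proof (intro allI impI)
    fix i assume "i < card B"
    then show "(t \<circ> h) i - \<delta> ((t \<circ> h) i) \<le> a i \<and> a i \<le> b i \<and> b i \<le> (t \<circ> h) i + \<delta> ((t \<circ> h) i)"
      using fine[of "h i"] hB[of i] L[of i] by (auto simp: B_def)
  qed
  ultimately have "norm (w - (\<Sum>k<card B. (b k - a k) *\<^sub>R \<phi> ((t \<circ> h) k))) \<le> \<epsilon>"
    by (rule bound)
  also have "(\<Sum>k<card B. (b k - a k) *\<^sub>R \<phi> ((t \<circ> h) k))
      = (\<Sum>k<card B. measure lborel (L (h k)) *\<^sub>R \<phi> (t (h k)))"
    using L by (intro sum.cong) auto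
  also have "\<dots> = (\<Sum>i\<in>B. measure lborel (L i) *\<^sub>R \<phi> (t i))"
    using h by (rule sum.reindex_bij_betw)
  also have "\<dots> = (\<Sum>i\<in>A. measure lborel (L i) *\<^sub>R \<phi> (t i))"
    using \<open>finite A\<close> by (intro sum.mono_neutral_left) (auto simp: B_def)
  finally show ?thesis .
qed

section \<open>Scalar McShane sums and the Henstock-Kurzweil integral\<close>

lemma gauge_ball_if_mcshane_gauge:
  assumes "mcshane_gauge \<delta>"
  shows "gauge (\<lambda>x. ball x (if x \<in> {0..1} then \<delta> x else 1))"
  \<comment> \<open>The radius 1 off \<open>{0..1}\<close> is a default value: tags of a division of
    \<open>{0..1}\<close> never lie there.\<close>
  using assms by (intro gauge_ball_dependent) (auto simp: mcshane_gauge_def)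

lemma ball_fine_subset:
  assumes "(\<lambda>x. ball x (if x \<in> {0..1} then \<delta> x else 1)) fine p" "(x, K) \<in> p" "x \<in> {0..1}"
  shows "K \<subseteq> {x - \<delta> x..x + \<delta> x}"
proof -
  have "K \<subseteq> ball x (\<delta> x)"
    using fineD[OF assms(1,2)] assms(3) by simp
  also have "\<dots> \<subseteq> {x - \<delta> x..x + \<delta> x}"
    by (auto simp: dist_real_def)
  finally show ?thesis .
qed

text \<open>A fine tagged division is a McShane partition whose tags happen to lie in their own
  intervals, so the McShane bound covers all Riemann sums of the Henstock-Kurzweil integral. This
  makes the calculus of \<open>has_integral\<close> available for scalar McShane integrands.\<close>

lemma has_integral_if_has_mcshane_integral:
  fixes g :: "real \<Rightarrow> real"
  assumes "has_mcshane_integral g w"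
  shows "(g has_integral w) {0..1}"
  unfolding has_integral_real
proof (intro allI impI)
  fix e :: real assume "e > 0"
  then obtain \<delta> where \<delta>: "mcshane_gauge \<delta>"
    and bound: "\<And>n a b t. mcshane_partition n a b t \<Longrightarrow> mcshane_subordinate \<delta> n a b t \<Longrightarrow>
      norm (w - (\<Sum>i<n. (b i - a i) *\<^sub>R g (t i))) \<le> e / 2"
    using assms unfolding has_mcshane_integral_def by (meson half_gt_zero)
  let ?\<gamma> = "\<lambda>x. ball x (if x \<in> {0..1} then \<delta> x else 1)"
  have "norm ((\<Sum>(x, K)\<in>p. measure lborel K *\<^sub>R g x) - w) < e"
    if p: "p tagged_division_of {0..1}" "?\<gamma> fine p" for p
  proof -
    note p' = tagged_division_ofD[OF p(1)]
    have "norm (w - (\<Sum>q\<in>p. measure lborel (snd q) *\<^sub>R g (fst q))) \<le> e / 2"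
    proof (rule mcshane_bound_indexed[OF bound])
      show "(\<Union>q\<in>p. snd q) = {0..1}"
        using p'(6) by force
      show "\<exists>u v. snd q = {u..v}" if "q \<in> p" for q
        using p'(4)[of "fst q" "snd q"] that by auto
      show "interior (snd q) \<inter> interior (snd r) = {}" if "q \<in> p" "r \<in> p" "q \<noteq> r" for q r
        using p'(5)[of "fst q" "snd q" "fst r" "snd r"] that by simp
      show tag: "fst q \<in> {0..1}" if "q \<in> p" for q
        using p'(2,3)[of "fst q" "snd q"] that by auto
      show "snd q \<subseteq> {fst q - \<delta> (fst q)..fst q + \<delta> (fst q)}" if "q \<in> p" for q
        using ball_fine_subset[OF p(2), of "fst q" "snd q"] tag[OF that] that by simp
    qed (use p' in auto)
    then show ?thesis
      using \<open>e > 0\<close> by (simp add: case_prod_beta abs_minus_commute)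
  qed
  then show "\<exists>\<gamma>. gauge \<gamma> \<and> (\<forall>p. p tagged_division_of {0..1} \<and> \<gamma> fine p \<longrightarrow>
      norm ((\<Sum>(x, K)\<in>p. measure lborel K *\<^sub>R g x) - w) < e)"
    using gauge_ball_if_mcshane_gauge[OF \<delta>] by blast
qed

text \<open>
  Because tags need not lie in their intervals, the cells
  \<open>K \<inter> {a i..b i}\<close> with \<open>K \<in> D'\<close> may keep the tag \<open>t i\<close>; they are completed to a subordinate
  partition by Henstock-Kurzweil partitions of the members of \<open>D - D'\<close>.
\<close>

lemma mcshane_henstock:
  fixes g :: "real \<Rightarrow> real"
  assumes g: "(g has_integral w) {0..1}" and \<delta>: "mcshane_gauge \<delta>"
    and bound: "\<And>n a b t. mcshane_partition n a b t \<Longrightarrow> mcshane_subordinate \<delta> n a b t \<Longrightarrow>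
      norm (w - (\<Sum>i<n. (b i - a i) *\<^sub>R g (t i))) \<le> \<epsilon>"
    and part: "mcshane_partition n a b t" and sub: "mcshane_subordinate \<delta> n a b t"
    and D: "D division_of {0..1}" and D': "D' \<subseteq> D"
  shows "\<bar>\<Sum>K\<in>D'. integral K g - (\<Sum>i<n. measure lborel (K \<inter> {a i..b i}) * g (t i))\<bar> \<le> \<epsilon>"
proof (rule field_le_epsilon)
  fix e :: real assume "e > 0"
  note D_props = division_ofD[OF D]
  have fin: "finite D'" "finite (D - D')"
    using D_props(1) D' finite_subset by auto
  let ?\<gamma> = "\<lambda>x. ball x (if x \<in> {0..1} then \<delta> x else 1)"
  \<comment> \<open>The error \<open>e\<close> pays for replacing the integrals over the members of
    \<open>D - D'\<close> by Riemann sums, at most \<open>card D\<close> of them; the added 1 guards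
    the division.\<close>
  define e' where "e' = e / (real (card D) + 1)"
  have "e' > 0"
    using \<open>e > 0\<close> by (simp add: e'_def)
  have "\<exists>p. p tagged_division_of K \<and> ?\<gamma> fine p \<and>
      \<bar>(\<Sum>(x, L)\<in>p. measure lborel L * g x) - integral K g\<bar> \<le> e'" if K: "K \<in> D" for K
  proof -
    obtain u v where uv: "K = cbox u v"
      using D_props(4)[OF K] by blast
    have "g integrable_on K"
      using integrable_on_subcbox[of g "{0..1}" u v] D_props(2)[OF K] g uv
      by (auto simp: integrable_on_def)
    then have "(g has_integral integral K g) (cbox u v)"
      unfolding uv by (rule integrable_integral)
    from has_integral[THEN iffD1, rule_format, OF this \<open>e' > 0\<close>]
    obtain \<gamma> where \<gamma>: "gauge \<gamma>" "\<And>p. p tagged_division_of cbox u v \<Longrightarrow> \<gamma> fine p \<Longrightarrow>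
        norm ((\<Sum>(x, L)\<in>p. measure lborel L *\<^sub>R g x) - integral K g) < e'"
      by metis
    obtain p where p: "p tagged_division_of cbox u v" "(\<lambda>x. ?\<gamma> x \<inter> \<gamma> x) fine p"
      using fine_division_exists[OF gauge_Int[OF gauge_ball_if_mcshane_gauge[OF \<delta>] \<gamma>(1)]] .
    then have "?\<gamma> fine p" "\<gamma> fine p"
      by (simp_all add: fine_Int)
    then show ?thesis
      using \<gamma>(2)[OF p(1)] p(1) uv by (intro exI[of _ p]) (simp add: less_imp_le)
  qed
  then have "\<forall>K\<in>D. \<exists>p. p tagged_division_of K \<and> ?\<gamma> fine p \<and>
      \<bar>(\<Sum>(x, L)\<in>p. measure lborel L * g x) - integral K g\<bar> \<le> e'"
    by blast
  from bchoice[OF this] obtain p where "\<forall>K\<in>D. p K tagged_division_of K \<and> ?\<gamma> fine p K \<and>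
      \<bar>(\<Sum>(x, L)\<in>p K. measure lborel L * g x) - integral K g\<bar> \<le> e'" ..
  then have p: "\<And>K. K \<in> D \<Longrightarrow> p K tagged_division_of K" "\<And>K. K \<in> D \<Longrightarrow> ?\<gamma> fine p K"
    "\<And>K. K \<in> D \<Longrightarrow> \<bar>(\<Sum>(x, L)\<in>p K. measure lborel L * g x) - integral K g\<bar> \<le> e'"
    by simp_all
  have ab: "a i \<le> b i" "{a i..b i} \<subseteq> {0..1}" "t i \<in> {0..1}" if "i < n" for i
    using part that unfolding mcshane_partition_def by blast+
  have ab_disj: "interior {a i..b i} \<inter> interior {a j..b j} = {}" if "i < n" "j < n" "i \<noteq> j" for i j
    using part that unfolding mcshane_partition_def by blast
  have ab_cover: "(\<Union>i<n. {a i..b i}) = {0..1}"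
    using part unfolding mcshane_partition_def by blast
  define A where "A = (D' \<times> {..<n}) <+> (SIGMA K:D - D'. p K)"
  define L where "L = case_sum (\<lambda>(K, i). K \<inter> {a i..b i}) (\<lambda>(K :: real set, x :: real, M). M)"
  define \<tau> where "\<tau> = case_sum (\<lambda>(K :: real set, i). t i) (\<lambda>(K :: real set, x, M :: real set). x)"
  have "norm (w - (\<Sum>c\<in>A. measure lborel (L c) *\<^sub>R g (\<tau> c))) \<le> \<epsilon>"
  proof (rule mcshane_bound_indexed[OF bound])
    show "finite A"
      unfolding A_def using fin p(1) by (intro finite_Plus finite_SigmaI) auto
    show "\<exists>u v. L c = {u..v}" if c_in: "c \<in> A" for c
    proof (cases c)
      case (Inl q)
      then obtain K i where c: "c = Inl (K, i)" "K \<in> D'"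
        using c_in by (auto simp: A_def)
      then obtain u v where "K = {u..v}"
        using D_props(4)[of K] D' by auto
      then show ?thesis
        using c by (auto simp: L_def Int_atLeastAtMost)
    next
      case (Inr q)
      then obtain K x M where c: "c = Inr (K, x, M)" "K \<in> D" "(x, M) \<in> p K"
        using c_in by (auto simp: A_def)
      then show ?thesis
        using tagged_division_ofD(4)[OF p(1)[OF c(2)] c(3)] by (auto simp: L_def)
    qed
    show "interior (L c) \<inter> interior (L c') = {}" if cc: "c \<in> A" "c' \<in> A" "c \<noteq> c'" for c c'
    proof -
      \<comment> \<open>\<open>\<kappa> c\<close> is the member of \<open>D\<close> that contains
        the cell \<open>c\<close>. Cells in distinct members are separated by the division
        \<open>D\<close>; cells in the same member are separated by the given partition or by
        \<open>p K\<close>.\<close>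
      define \<kappa> where "\<kappa> = case_sum (fst :: real set \<times> nat \<Rightarrow> _) (fst :: real set \<times> real \<times> real set \<Rightarrow> _)"
      have \<kappa>: "\<kappa> c \<in> D \<and> L c \<subseteq> \<kappa> c" if c_in: "c \<in> A" for c
      proof (cases c)
        case (Inl q)
        then show ?thesis
          using that D' by (auto simp: A_def L_def \<kappa>_def)
      next
        case (Inr q)
        then obtain K x M where c: "c = Inr (K, x, M)" "K \<in> D" "(x, M) \<in> p K"
          using c_in by (auto simp: A_def)
        then show ?thesis
          using tagged_division_ofD(3)[OF p(1)[OF c(2)] c(3)] by (auto simp: L_def \<kappa>_def)
      qed
      show ?thesis
      proof (cases "\<kappa> c = \<kappa> c'")
        case False
        then have "interior (\<kappa> c) \<inter> interior (\<kappa> c') = {}"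
          using D_props(5)[of "\<kappa> c" "\<kappa> c'"] \<kappa> cc by simp
        then show ?thesis
          using \<kappa>[OF cc(1)] \<kappa>[OF cc(2)] interior_mono[of "L c" "\<kappa> c"]
            interior_mono[of "L c'" "\<kappa> c'"] by fast
      next
        case True
        then have "(\<exists>K i j. c = Inl (K, i) \<and> c' = Inl (K, j) \<and> i < n \<and> j < n \<and> i \<noteq> j) \<or>
            (\<exists>K q r. K \<in> D \<and> c = Inr (K, q) \<and> c' = Inr (K, r) \<and> q \<in> p K \<and> r \<in> p K \<and> q \<noteq> r)"
          using cc unfolding A_def \<kappa>_def by (cases c; cases c') auto
        then consider K i j where "c = Inl (K, i)" "c' = Inl (K, j)" "i < n" "j < n" "i \<noteq> j"
          | K q r where "K \<in> D" "c = Inr (K, q)" "c' = Inr (K, r)" "q \<in> p K" "r \<in> p K" "q \<noteq> r"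
          by blast
        then show ?thesis
        proof cases
          case 1
          then show ?thesis
            using ab_disj[of i j] by (auto simp: L_def)
        next
          case 2
          then show ?thesis
            using tagged_division_ofD(5)[OF p(1)[of K], of "fst q" "snd q" "fst r" "snd r"]
            by (auto simp: L_def case_prod_beta)
        qed
      qed
    qed
    show "(\<Union>c\<in>A. L c) = {0..1}"
    proof -
      have "(\<Union>c\<in>A. L c) = (\<Union>K\<in>D'. \<Union>i<n. K \<inter> {a i..b i}) \<union> (\<Union>K\<in>D - D'. \<Union>q\<in>p K. snd q)"
        unfolding A_def L_def by (simp add: Plus_def Sigma_def case_prod_beta)
      also have "(\<Union>K\<in>D'. \<Union>i<n. K \<inter> {a i..b i}) = \<Union>D'"
      proof -
        have "(\<Union>i<n. K \<inter> {a i..b i}) = K" if "K \<in> D'" for K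
          using ab_cover D_props(2)[of K] that D' by (auto simp: Int_absorb2 simp flip: Int_UN_distrib)
        then show ?thesis
          by simp
      qed
      also have "(\<Union>K\<in>D - D'. \<Union>q\<in>p K. snd q) = \<Union>(D - D')"
      proof -
        have "(\<Union>q\<in>p K. snd q) = K" if "K \<in> D" for K
        proof -
          have "(\<Union>q\<in>p K. snd q) = \<Union>{L. \<exists>x. (x, L) \<in> p K}"
            by force
          then show ?thesis
            using tagged_division_ofD(6)[OF p(1)[OF that]] by simp
        qed
        then show ?thesis
          by auto
      qed
      also have "\<Union>D' \<union> \<Union>(D - D') = \<Union>D"
        using D' by blast
      finally show ?thesis
        using D_props(6) by simp
    qed
    have tag_in: "x \<in> {0..1}" if "K \<in> D" "(x, M) \<in> p K" for K x M
      using tagged_division_ofD(2,3)[OF p(1)[OF that(1)] that(2)] D_props(2)[OF that(1)] by blast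
    show "\<tau> c \<in> {0..1}" if c_in: "c \<in> A" for c
      using that ab(3) tag_in by (auto simp: A_def \<tau>_def)
    show "L c \<subseteq> {\<tau> c - \<delta> (\<tau> c)..\<tau> c + \<delta> (\<tau> c)}" if c_in: "c \<in> A" for c
    proof (cases c)
      case (Inl q)
      then obtain K i where c: "c = Inl (K, i)" "i < n"
        using c_in by (auto simp: A_def)
      then have "L c \<subseteq> {a i..b i}" "\<tau> c = t i"
        by (auto simp: L_def \<tau>_def)
      moreover have "t i - \<delta> (t i) \<le> a i" "b i \<le> t i + \<delta> (t i)"
        using sub c(2) by (auto simp: mcshane_subordinate_def)
      ultimately show ?thesis
        by fastforce
    next
      case (Inr q)
      then obtain K x M where c: "c = Inr (K, x, M)" "K \<in> D" "(x, M) \<in> p K"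
        using c_in by (auto simp: A_def)
      then show ?thesis
        using ball_fine_subset[OF p(2) c(3)] tag_in by (auto simp: L_def \<tau>_def)
    qed
  qed
  also have "(\<Sum>c\<in>A. measure lborel (L c) *\<^sub>R g (\<tau> c))
      = (\<Sum>K\<in>D'. \<Sum>i<n. measure lborel (K \<inter> {a i..b i}) * g (t i))
        + (\<Sum>K\<in>D - D'. \<Sum>(x, L)\<in>p K. measure lborel L * g x)"
  proof -
    have p_fin: "finite (p K)" if "K \<in> D" for K
      using p(1)[OF that] by blast
    then have "finite (SIGMA K:D - D'. p K)"
      using fin by auto
    then have "(\<Sum>c\<in>A. measure lborel (L c) *\<^sub>R g (\<tau> c))
        = (\<Sum>(K, i)\<in>D' \<times> {..<n}. measure lborel (K \<inter> {a i..b i}) * g (t i))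
          + (\<Sum>(K, x, M)\<in>(SIGMA K:D - D'. p K). measure lborel M * g x)"
      unfolding A_def using fin(1) by (simp add: sum.Plus L_def \<tau>_def case_prod_beta)
    also have "(\<Sum>(K, i)\<in>D' \<times> {..<n}. measure lborel (K \<inter> {a i..b i}) * g (t i))
        = (\<Sum>K\<in>D'. \<Sum>i<n. measure lborel (K \<inter> {a i..b i}) * g (t i))"
      by (rule sum.cartesian_product[symmetric])
    also have "(\<Sum>(K, x, M)\<in>(SIGMA K:D - D'. p K). measure lborel M * g x)
        = (\<Sum>K\<in>D - D'. \<Sum>(x, L)\<in>p K. measure lborel L * g x)"
      using fin(2) p_fin by (intro sum.Sigma[symmetric]) auto
    finally show ?thesis .
  qed
  also have "w = (\<Sum>K\<in>D'. integral K g) + (\<Sum>K\<in>D - D'. integral K g)"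
  proof -
    have "w = (\<Sum>K\<in>D. integral K g)"
      using integral_combine_division_topdown[OF _ D, of g] g by (auto simp: has_integral_iff)
    then show ?thesis
      using sum.subset_diff[OF D' D_props(1), of "\<lambda>K. integral K g"] by simp
  qed
  \<comment> \<open>With \<open>w\<close> split along \<open>D'\<close> and \<open>D - D'\<close>,
    the bound controls the wanted sum minus the error of the auxiliary divisions \<open>p K\<close>,
    and that error is at most \<open>e\<close>.\<close>
  finally have "\<bar>(\<Sum>K\<in>D'. integral K g - (\<Sum>i<n. measure lborel (K \<inter> {a i..b i}) * g (t i)))
      - (\<Sum>K\<in>D - D'. (\<Sum>(x, L)\<in>p K. measure lborel L * g x) - integral K g)\<bar> \<le> \<epsilon>"
    by (simp add: sum_subtractf algebra_simps)
  moreover have "\<bar>\<Sum>K\<in>D - D'. (\<Sum>(x, L)\<in>p K. measure lborel L * g x) - integral K g\<bar> \<le> e"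
  proof -
    have "\<bar>\<Sum>K\<in>D - D'. (\<Sum>(x, L)\<in>p K. measure lborel L * g x) - integral K g\<bar> \<le> (\<Sum>K\<in>D - D'. e')"
      using p(3) by (intro order_trans[OF sum_abs sum_mono]) auto
    also have "\<dots> = real (card (D - D')) * e'"
      by simp
    also have "\<dots> \<le> (real (card D) + 1) * e'"
      using \<open>e' > 0\<close> card_mono[OF D_props(1), of "D - D'"] by (intro mult_right_mono) auto
    also have "\<dots> = e"
      by (simp add: e'_def)
    finally show ?thesis .
  qed
  ultimately show "\<bar>\<Sum>K\<in>D'. integral K g - (\<Sum>i<n. measure lborel (K \<inter> {a i..b i}) * g (t i))\<bar> \<le> \<epsilon> + e"
    by linarith
qed

text \<open>The constant \<open>B\<close> survives because one division can be fine for two gauges.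
  On it the integral of the norm differs from its Riemann sum by less than \<open>e / 2\<close>, and
  Henstock's lemma replaces each \<open>norm (measure lborel K *\<^sub>R h x)\<close> by
  \<open>norm (integral K h)\<close> at a total cost of \<open>e / 2\<close>.\<close>

lemma integral_norm_le_variation:
  fixes h :: "'n::euclidean_space \<Rightarrow> 'm::euclidean_space"
  assumes h: "h integrable_on cbox a b"
    and var: "\<And>D. D division_of cbox a b \<Longrightarrow> (\<Sum>K\<in>D. norm (integral K h)) \<le> B"
  shows "h absolutely_integrable_on cbox a b" "integral (cbox a b) (\<lambda>x. norm (h x)) \<le> B"
proof -
  show abs: "h absolutely_integrable_on cbox a b"
    by (rule bounded_variation_absolutely_integrable_interval[OF h var])
  have "integral (cbox a b) (\<lambda>x. norm (h x)) \<le> B + e" if "e > 0" for e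
  proof -
    have "((\<lambda>x. norm (h x)) has_integral integral (cbox a b) (\<lambda>x. norm (h x))) (cbox a b)"
      using abs by (simp add: absolutely_integrable_on_def integrable_integral)
    then obtain \<gamma>1 where \<gamma>1: "gauge \<gamma>1" "\<And>p. p tagged_division_of cbox a b \<Longrightarrow> \<gamma>1 fine p \<Longrightarrow>
        norm ((\<Sum>(x, K)\<in>p. measure lborel K *\<^sub>R norm (h x)) - integral (cbox a b) (\<lambda>x. norm (h x))) < e / 2"
      using \<open>e > 0\<close> unfolding has_integral by (meson half_gt_zero)
    obtain \<gamma>2 where \<gamma>2: "gauge \<gamma>2" "\<And>p. p tagged_partial_division_of cbox a b \<Longrightarrow> \<gamma>2 fine p \<Longrightarrow>
        (\<Sum>(x, K)\<in>p. norm (measure lborel K *\<^sub>R h x - integral K h)) < e / 2"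
      using Henstock_lemma[OF h, of "e / 2"] \<open>e > 0\<close> by auto
    obtain p where p: "p tagged_division_of cbox a b" "(\<lambda>x. \<gamma>1 x \<inter> \<gamma>2 x) fine p"
      using fine_division_exists[OF gauge_Int[OF \<gamma>1(1) \<gamma>2(1)]] .
    have "integral (cbox a b) (\<lambda>x. norm (h x)) \<le> (\<Sum>(x, K)\<in>p. measure lborel K *\<^sub>R norm (h x)) + e / 2"
    proof -
      have "norm ((\<Sum>(x, K)\<in>p. measure lborel K *\<^sub>R norm (h x)) - integral (cbox a b) (\<lambda>x. norm (h x))) < e / 2"
        using \<gamma>1(2)[OF p(1)] p(2) by (simp only: fine_Int)
      then show ?thesis
        unfolding real_norm_def by linarith
    qed
    also have "(\<Sum>(x, K)\<in>p. measure lborel K *\<^sub>R norm (h x))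
        \<le> (\<Sum>(x, K)\<in>p. norm (integral K h) + norm (measure lborel K *\<^sub>R h x - integral K h))"
    proof (rule sum_mono, clarify)
      fix x :: 'n and K :: "'n set"
      have "measure lborel K *\<^sub>R norm (h x) = norm (measure lborel K *\<^sub>R h x)"
        by simp
      then show "measure lborel K *\<^sub>R norm (h x) \<le> norm (integral K h) + norm (measure lborel K *\<^sub>R h x - integral K h)"
        using norm_triangle_sub[of "measure lborel K *\<^sub>R h x" "integral K h"] by simp
    qed
    also have "\<dots> = (\<Sum>(x, K)\<in>p. norm (integral K h)) + (\<Sum>(x, K)\<in>p. norm (measure lborel K *\<^sub>R h x - integral K h))"
      by (simp add: case_prod_beta sum.distrib)
    \<comment> \<open>A set that carries two tags has empty interior, hence integral 0, so the
      passage from tagged pairs to sets loses nothing.\<close>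
    also have "(\<Sum>(x, K)\<in>p. norm (integral K h)) = (\<Sum>K\<in>snd ` p. norm (integral K h))"
      by (rule sum.over_tagged_division_lemma[OF p(1)]) (simp add: integral_null content_eq_0_interior)
    also have "\<dots> \<le> B"
      by (rule var[OF division_of_tagged_division[OF p(1)]])
    also have "(\<Sum>(x, K)\<in>p. norm (measure lborel K *\<^sub>R h x - integral K h)) \<le> e / 2"
      using \<gamma>2(2)[of p] p by (simp add: fine_Int tagged_division_of_def)
    finally show ?thesis
      by simp
  qed
  then show "integral (cbox a b) (\<lambda>x. norm (h x)) \<le> B"
    by (rule field_le_epsilon)
qed

text \<open>Let \<open>s\<close> be the step function of the partition and \<open>h = g - s\<close>.
  Henstock's lemma bounds the signed sum of the integrals of \<open>h\<close> over any subfamily of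
  a division by \<open>\<epsilon>\<close>. Separating the members with nonnegative integral from the
  others bounds the variation, hence the L1 norm of \<open>h\<close>, by
  \<open>2 * \<epsilon>\<close>, and integrating over \<open>E\<close> costs no more.\<close>

lemma mcshane_scalar_estimate:
  fixes g :: "real \<Rightarrow> real"
  assumes g: "(g has_integral w) {0..1}" and \<delta>: "mcshane_gauge \<delta>"
    and bound: "\<And>n a b t. mcshane_partition n a b t \<Longrightarrow> mcshane_subordinate \<delta> n a b t \<Longrightarrow>
      norm (w - (\<Sum>i<n. (b i - a i) *\<^sub>R g (t i))) \<le> \<epsilon>"
    and part: "mcshane_partition n a b t" and sub: "mcshane_subordinate \<delta> n a b t"
  shows "integrable (lebesgue_on {0..1}) g"
    and "\<And>E. E \<in> sets (lebesgue_on {0..1}) \<Longrightarrow> \<bar>(LINT x:E|lebesgue_on {0..1}. g x)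
      - (\<Sum>i<n. measure lebesgue (E \<inter> {a i..b i}) * g (t i))\<bar> \<le> 2 * \<epsilon>"
proof -
  let ?M = "lebesgue_on {0..1::real}"
  define s where "s x = (\<Sum>i<n. indicator {a i..b i} x * g (t i))" for x
  define h where "h x = g x - s x" for x
  have s_int: "(s has_integral (\<Sum>i<n. measure lborel (cbox u v \<inter> {a i..b i}) * g (t i))) (cbox u v)" for u v
  proof -
    have "(indicat_real {a i..b i} has_integral measure lborel (cbox u v \<inter> {a i..b i})) (cbox u v)" for i
    proof -
      have "{a i..b i} \<inter> cbox u v \<in> lmeasurable"
        by (simp add: Int_atLeastAtMost)
      then have "indicat_real {a i..b i} integrable_on cbox u v"
        "integral (cbox u v) (indicat_real {a i..b i}) = measure lebesgue ({a i..b i} \<inter> cbox u v)"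
        by (simp_all add: integrable_on_indicator Equivalence_Lebesgue_Henstock_Integration.integral_indicator)
      then show ?thesis
        by (simp add: has_integral_iff Int_commute Int_atLeastAtMost)
    qed
    then show ?thesis
      unfolding s_def by (intro has_integral_sum has_integral_mult_left) auto
  qed
  have g_sub: "g integrable_on K" if "K \<subseteq> {0..1}" "K = cbox u v" for K u v
    using integrable_on_subcbox[of g "{0..1}" u v] g that by (auto simp: integrable_on_def)
  have h_int: "h integrable_on cbox 0 1"
    unfolding h_def using g s_int[of 0 1] by (auto intro!: integrable_diff simp: integrable_on_def)
  have var: "(\<Sum>K\<in>D. norm (integral K h)) \<le> 2 * \<epsilon>" if "D division_of cbox 0 1" for D
  proof -
    have D: "D division_of {0..1}"
      using that by simp
    have "integral K h = integral K g - (\<Sum>i<n. measure lborel (K \<inter> {a i..b i}) * g (t i))" if K: "K \<in> D" for K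
    proof -
      obtain u v where uv: "K = cbox u v"
        using division_ofD(4)[OF D K] by blast
      then have "(h has_integral integral K g - (\<Sum>i<n. measure lborel (K \<inter> {a i..b i}) * g (t i))) K"
        unfolding h_def using s_int g_sub[OF division_ofD(2)[OF D K] uv]
        by (intro has_integral_diff integrable_integral) auto
      then show ?thesis
        by (rule integral_unique)
    qed
    then have partial: "\<bar>\<Sum>K\<in>D'. integral K h\<bar> \<le> \<epsilon>" if "D' \<subseteq> D" for D'
      using mcshane_henstock[OF g \<delta> bound part sub D that] that by (simp add: subset_iff)
    define P where "P = {K \<in> D. integral K h \<ge> 0}"
    have "(\<Sum>K\<in>D. norm (integral K h)) = (\<Sum>K\<in>D - P. norm (integral K h)) + (\<Sum>K\<in>P. norm (integral K h))"
      using division_ofD(1)[OF D] by (intro sum.subset_diff) (auto simp: P_def)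
    also have "(\<Sum>K\<in>D - P. norm (integral K h)) = - (\<Sum>K\<in>D - P. integral K h)"
      unfolding sum_negf[symmetric] by (intro sum.cong) (auto simp: P_def)
    also have "(\<Sum>K\<in>P. norm (integral K h)) = (\<Sum>K\<in>P. integral K h)"
      by (intro sum.cong) (auto simp: P_def)
    also have "- (\<Sum>K\<in>D - P. integral K h) + (\<Sum>K\<in>P. integral K h) \<le> 2 * \<epsilon>"
      using partial[of P] partial[of "D - P"] by (auto simp: P_def abs_le_iff)
    finally show ?thesis .
  qed
  have h_abs: "h absolutely_integrable_on {0..1}"
    and h_le: "integral {0..1} (\<lambda>x. norm (h x)) \<le> 2 * \<epsilon>"
    using integral_norm_le_variation[OF h_int var] by simp_all
  have hM: "integrable ?M h"
    using h_abs by (rule absolutely_integrable_imp_integrable) simp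
  have ind: "integrable ?M (\<lambda>x. indicator E x * indicator {a i..b i} x * c)"
      "(LINT x|?M. indicator E x * indicator {a i..b i} x * c) = measure lebesgue (E \<inter> {a i..b i}) * c"
    if E: "E \<in> sets ?M" and i: "i < n" for E i and c :: real
  proof -
    have "{a i..b i} \<subseteq> {0..1}"
      using part i unfolding mcshane_partition_def by blast
    then have EI: "E \<inter> {a i..b i} \<in> sets ?M" "E \<inter> {a i..b i} \<subseteq> {0..1}"
      using E by (auto simp: sets_restrict_space_iff)
    interpret finite_measure ?M
      by (intro finite_measure_lebesgue_on) simp
    have "integrable ?M (indicat_real (E \<inter> {a i..b i}))"
      using EI by (simp add: emeasure_eq_measure integrable_indicator_iff Int_absorb2)
    moreover have "(LINT x|?M. indicat_real (E \<inter> {a i..b i}) x) = measure lebesgue (E \<inter> {a i..b i})"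
      using EI by (simp add: measure_restrict_space Int_absorb2)
    ultimately show "integrable ?M (\<lambda>x. indicator E x * indicator {a i..b i} x * c)"
      "(LINT x|?M. indicator E x * indicator {a i..b i} x * c) = measure lebesgue (E \<inter> {a i..b i}) * c"
      by (simp_all add: indicator_inter_arith[symmetric] del: Bochner_Integration.integral_indicator)
  qed
  have Es: "integrable ?M (\<lambda>x. indicator E x * s x)"
    "(LINT x:E|?M. s x) = (\<Sum>i<n. measure lebesgue (E \<inter> {a i..b i}) * g (t i))"
    if E: "E \<in> sets ?M" for E
  proof -
    have eq: "(\<lambda>x. indicator E x * s x) = (\<lambda>x. \<Sum>i<n. indicator E x * indicator {a i..b i} x * g (t i))"
      by (simp only: s_def sum_distrib_left mult.assoc)
    show "integrable ?M (\<lambda>x. indicator E x * s x)"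
      unfolding eq using ind(1)[OF E] by (intro Bochner_Integration.integrable_sum) auto
    show "(LINT x:E|?M. s x) = (\<Sum>i<n. measure lebesgue (E \<inter> {a i..b i}) * g (t i))"
      unfolding set_lebesgue_integral_def real_scaleR_def eq
      using ind[OF E] by (subst Bochner_Integration.integral_sum) (auto simp only: lessThan_iff intro: sum.cong)
  qed
  have sM: "integrable ?M s"
  proof -
    have "integrable ?M s \<longleftrightarrow> integrable ?M (\<lambda>x. indicator {0..1} x * s x)"
      by (intro Bochner_Integration.integrable_cong) auto
    then show ?thesis
      using Es(1)[of "{0..1}"] by simp
  qed
  have g_eq: "g = (\<lambda>x. h x + s x)"
    by (simp add: h_def)
  show "integrable ?M g"
    unfolding g_eq using hM sM by simp
  fix E assume E: "E \<in> sets ?M"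
  have hE: "integrable ?M (\<lambda>x. indicator E x * h x)"
    using integrable_mult_indicator[OF E hM] by simp
  have "(LINT x:E|?M. g x) = (LINT x:E|?M. h x) + (LINT x:E|?M. s x)"
    using hE Es(1)[OF E] unfolding g_eq set_lebesgue_integral_def by (simp add: distrib_left)
  then have "(LINT x:E|?M. g x) - (\<Sum>i<n. measure lebesgue (E \<inter> {a i..b i}) * g (t i)) = (LINT x:E|?M. h x)"
    by (simp add: Es(2)[OF E])
  also have "\<bar>\<dots>\<bar> \<le> (LINT x|?M. \<bar>indicator E x * h x\<bar>)"
    unfolding set_lebesgue_integral_def real_scaleR_def by (rule integral_abs_bound)
  also have "\<dots> \<le> (LINT x|?M. norm (h x))"
    using hE hM by (intro integral_mono) (auto simp: indicator_def)
  also have "\<dots> = integral {0..1} (\<lambda>x. norm (h x))"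
    using hM by (intro lebesgue_integral_eq_integral) auto
  also have "\<dots> \<le> 2 * \<epsilon>"
    by (rule h_le)
  finally show "\<bar>(LINT x:E|?M. g x) - (\<Sum>i<n. measure lebesgue (E \<inter> {a i..b i}) * g (t i))\<bar> \<le> 2 * \<epsilon>" .
qed

section \<open>The indefinite Pettis integral\<close>

text \<open>Absolute continuity of the integral, by truncation: dominated convergence yields a
  height \<open>K\<close> above which \<open>\<bar>g\<bar>\<close> has integral below
  \<open>e / 2\<close>, and on the rest of \<open>A\<close> the integrand is at most
  \<open>K\<close>.\<close>

lemma integral_uniformly_small_on_small_sets:
  fixes g :: "'a \<Rightarrow> real"
  assumes g: "integrable M g" and "e > 0"
  obtains d where "d > 0"
    and "\<And>A. A \<in> fmeasurable M \<Longrightarrow> measure M A \<le> d \<Longrightarrow> \<bar>LINT x:A|M. g x\<bar> \<le> e"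
proof -
  define h where "h K x = (if \<bar>g x\<bar> > real K then \<bar>g x\<bar> else 0)" for K x
  note [measurable] = borel_measurable_integrable[OF g]
  have h_meas [measurable]: "h K \<in> borel_measurable M" for K
    unfolding h_def by measurable
  have "(\<lambda>K. LINT x|M. h K x) \<longlonglongrightarrow> (LINT x|M. 0)"
  proof (rule integral_dominated_convergence[where w = "\<lambda>x. \<bar>g x\<bar>"])
    show "AE x in M. (\<lambda>K. h K x) \<longlonglongrightarrow> 0"
    proof (rule AE_I2)
      fix x
      obtain N where "\<bar>g x\<bar> \<le> real N"
        using real_arch_simple by blast
      then have "\<forall>K\<ge>N. h K x = 0"
        by (auto simp: h_def)
      then have "\<forall>\<^sub>F K in sequentially. h K x = 0"
        unfolding eventually_sequentially by blast
      then show "(\<lambda>K. h K x) \<longlonglongrightarrow> 0"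
        by (rule tendsto_eventually)
    qed
  qed (use g in \<open>auto simp: h_def\<close>)
  then have "\<forall>\<^sub>F K in sequentially. (LINT x|M. h K x) < e / 2"
    using \<open>e > 0\<close> by (intro order_tendstoD(2)) auto
  then obtain K where K: "(LINT x|M. h K x) < e / 2"
    by (auto simp: eventually_sequentially)
  have h_int: "integrable M (h K)"
    by (rule Bochner_Integration.integrable_bound[OF g]) (auto simp: h_def)
  show thesis
  proof (rule that)
    \<comment> \<open>The height is raised to \<open>real K + 1\<close> so that \<open>K = 0\<close>
      gives no zero denominator.\<close>
    show "e / (2 * (real K + 1)) > 0"
      using \<open>e > 0\<close> by simp
    fix A assume A: "A \<in> fmeasurable M" and le: "measure M A \<le> e / (2 * (real K + 1))"
    have iA: "integrable M (\<lambda>x. indicator A x * (real K + 1))"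
      using A by (intro integrable_mult_left) (auto simp: fmeasurable_def)
    have "\<bar>LINT x:A|M. g x\<bar> \<le> (LINT x|M. \<bar>indicator A x * g x\<bar>)"
      unfolding set_lebesgue_integral_def real_scaleR_def by (rule integral_abs_bound)
    also have "\<dots> \<le> (LINT x|M. h K x + indicator A x * (real K + 1))"
    proof (rule integral_mono)
      show "integrable M (\<lambda>x. \<bar>indicator A x * g x\<bar>)"
        using g A by (intro integrable_abs) (auto intro: integrable_real_mult_indicator simp: fmeasurable_def mult.commute)
      show "integrable M (\<lambda>x. h K x + indicator A x * (real K + 1))"
        using h_int iA by simp
    qed (auto simp: h_def indicator_def)
    also have "\<dots> = (LINT x|M. h K x) + measure M A * (real K + 1)"
    proof -
      have "(LINT x|M. indicator A x) = measure M A"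
        using A by (simp add: fmeasurable_def sets.Int_space_eq2)
      then show ?thesis
        using h_int iA by (simp del: integral_indicator)
    qed
    also have "\<dots> \<le> e / 2 + e / (2 * (real K + 1)) * (real K + 1)"
      using K le by (intro add_mono mult_right_mono) auto
    also have "\<dots> = e"
      by (simp add: field_simps)
    finally show "\<bar>LINT x:A|M. g x\<bar> \<le> e" .
  qed
qed

text \<open>Functionals that norm the points of a dense sequence detect the closed ball: if all of
  them are at most \<open>r\<close> at \<open>y\<close>, then approximating \<open>y\<close> by some
  \<open>z n\<close> gives \<open>norm y \<le> r\<close>. The set is therefore a countable
  intersection of weakly measurable ones.\<close>

lemma measurable_set_norm_le:
  fixes \<phi> :: "'b \<Rightarrow> 'a::real_normed_vector" and z :: "nat \<Rightarrow> 'a"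
  assumes weak: "\<And>f :: 'a \<Rightarrow>\<^sub>L real. (\<lambda>x. blinfun_apply f (\<phi> x)) \<in> borel_measurable M"
    and dense: "\<And>x e. e > 0 \<Longrightarrow> \<exists>n. norm (x - z n) < e"
  shows "{x \<in> space M. norm (\<phi> x - c) \<le> r} \<in> sets M"
proof -
  have "\<exists>f :: 'a \<Rightarrow>\<^sub>L real. norm f \<le> 1 \<and> blinfun_apply f (z n) = norm (z n)" for n
    using norming_functional by metis
  then obtain f :: "nat \<Rightarrow> 'a \<Rightarrow>\<^sub>L real"
    where f: "\<And>n. norm (f n) \<le> 1" "\<And>n. blinfun_apply (f n) (z n) = norm (z n)"
    by metis
  have "norm y \<le> r \<longleftrightarrow> (\<forall>n. blinfun_apply (f n) y \<le> r)" for y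
  proof
    assume "norm y \<le> r"
    then show "\<forall>n. blinfun_apply (f n) y \<le> r"
      using blinfun_apply_le_norm[OF f(1), of _ y] by (meson abs_le_D1 order_trans)
  next
    assume *: "\<forall>n. blinfun_apply (f n) y \<le> r"
    show "norm y \<le> r"
    proof (rule field_le_epsilon)
      fix e :: real assume "e > 0"
      then obtain n where n: "norm (y - z n) < e / 2"
        using dense[of "e / 2"] by auto
      have "norm y \<le> norm (z n) + norm (y - z n)"
        by (metis add.commute diff_add_cancel norm_triangle_ineq)
      also have "norm (z n) = blinfun_apply (f n) y - blinfun_apply (f n) (y - z n)"
        using f(2)[of n] by (simp add: blinfun.diff_right)
      also have "\<dots> \<le> r + norm (y - z n)"
        using * blinfun_apply_le_norm[OF f(1), of n "y - z n"] by (smt (verit))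
      finally show "norm y \<le> r + e"
        using n by simp
    qed
  qed
  then have "{x \<in> space M. norm (\<phi> x - c) \<le> r}
      = {x \<in> space M. \<forall>n. blinfun_apply (f n) (\<phi> x) - blinfun_apply (f n) c \<le> r}"
    by (simp add: blinfun.diff_right)
  also have "\<dots> \<in> sets M"
    using weak by measurable
  finally show ?thesis .
qed

text \<open>Pettis integrability over a finite measure, with the integrals over measurable sets
  collected in one function \<open>W\<close>. As functionals separate points, \<open>W E\<close> is
  determined for measurable \<open>E\<close>. All integrals are set integrals on the one space
  \<open>M\<close>, so scalar additivity applies directly.\<close>

locale indefinite_pettis_integral = finite_measure M for M :: "'b measure" +
  fixes \<phi> :: "'b \<Rightarrow> 'a::real_normed_vector" and W :: "'b set \<Rightarrow> 'a"
  assumes weakly_integrable: "\<And>f :: 'a \<Rightarrow>\<^sub>L real. integrable M (\<lambda>x. blinfun_apply f (\<phi> x))"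
    and weak_integral: "\<And>E (f :: 'a \<Rightarrow>\<^sub>L real). E \<in> sets M \<Longrightarrow>
      (LINT x:E|M. blinfun_apply f (\<phi> x)) = blinfun_apply f (W E)"
begin

lemma set_integrable_functional:
  fixes f :: "'a \<Rightarrow>\<^sub>L real"
  assumes "E \<in> sets M"
  shows "set_integrable M E (\<lambda>x. blinfun_apply f (\<phi> x))"
  unfolding set_integrable_def using integrable_mult_indicator[OF assms weakly_integrable] .

lemma functional_W_Un:
  fixes f :: "'a \<Rightarrow>\<^sub>L real"
  assumes "A \<in> sets M" "B \<in> sets M" "A \<inter> B = {}"
  shows "blinfun_apply f (W (A \<union> B)) = blinfun_apply f (W A) + blinfun_apply f (W B)"
  using set_integral_Un[OF assms(3) set_integrable_functional set_integrable_functional, of f] assms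
  by (simp add: weak_integral)

lemma W_Un:
  assumes "A \<in> sets M" "B \<in> sets M" "A \<inter> B = {}"
  shows "W (A \<union> B) = W A + W B"
proof -
  have "norm (W (A \<union> B) - (W A + W B)) \<le> 0"
    by (rule norm_le_if_functionals_le)
      (simp add: functional_W_Un[OF assms] blinfun.diff_right blinfun.add_right)
  then show ?thesis
    by simp
qed

text \<open>
  A Baire category argument in the complete metric space of measurable sets modulo null sets:
  the sets \<open>{A. norm (W A - z k) \<le> e / 2}\<close> are closed and cover the space, so one of
  them contains a ball, which can be translated to the empty set.
\<close>

lemma W_uniformly_small_on_small_sets:
  fixes z :: "nat \<Rightarrow> 'a"
  assumes dense: "\<And>x e. e > 0 \<Longrightarrow> \<exists>n. norm (x - z n) < e" and "e > 0"
  shows "\<exists>d>0. \<forall>R\<in>sets M. measure M R \<le> d \<longrightarrow> norm (W R) \<le> e"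
proof (rule ccontr)
  assume "\<not> ?thesis"
  then have large: "\<exists>R. R \<in> sets M \<and> measure M R \<le> d \<and> norm (W R) > e" if "d > 0" for d
    using that by (meson not_le)
  \<comment> \<open>The avoidance condition of the category argument: in the metric given by the
    measure of the symmetric difference, the closed ball of radius \<open>d\<close> about
    \<open>A\<close> contains no set whose \<open>W\<close> is within \<open>e / 2\<close> of
    \<open>z k\<close>.\<close>
  define close where "close A d k \<longleftrightarrow> (\<forall>B \<in> sets M. measure M (sym_diff B A) \<le> d \<longrightarrow>
    norm (W B - z k) > e / 2)" for A d k
  \<comment> \<open>Every ball contains a smaller one that avoids \<open>z k\<close>. A small
    \<open>R\<close> with \<open>norm (W R) > e\<close> makes \<open>W (A \<union> R)\<close> and
    \<open>W (A - R)\<close> differ by more than \<open>e\<close>, so one of them is farther than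
    \<open>e / 2\<close> from \<open>z k\<close>.\<close>
  have step: "\<exists>A' d'. A' \<in> sets M \<and> 0 < d' \<and> d' \<le> d / 2 \<and>
      measure M (sym_diff A' A) \<le> d / 2 \<and> close A' d' k"
    if A: "A \<in> sets M" and "d > 0" for A d k
  proof -
    obtain R where R: "R \<in> sets M" "measure M R \<le> d / 2" "norm (W R) > e"
      using large[of "d / 2"] \<open>d > 0\<close> by auto
    have "W (A \<union> R) = W (A - R) + W R"
      using W_Un[of "A - R" R] A R(1) by (simp add: Int_commute)
    then have "W R = (W (A \<union> R) - z k) - (W (A - R) - z k)"
      by simp
    then have "norm (W R) \<le> norm (W (A \<union> R) - z k) + norm (W (A - R) - z k)"
      by (metis norm_triangle_ineq4)
    then consider "norm (W (A \<union> R) - z k) > e / 2" | "norm (W (A - R) - z k) > e / 2"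
      using R(3) by linarith
    then obtain A' where A': "A' = A \<union> R \<or> A' = A - R" "norm (W A' - z k) > e / 2"
      by metis
    have A'_sets: "A' \<in> sets M"
      using A R A' by auto
    have "measure M (sym_diff A' A) \<le> measure M R"
      using R(1) A' by (intro finite_measure_mono) auto
    then have A'_near: "measure M (sym_diff A' A) \<le> d / 2"
      using R(2) by linarith
    \<comment> \<open>Continuity of \<open>W\<close> in norm is what is being proved, so the
      avoidance is spread to a ball through one functional norming \<open>W A' - z k\<close>, whose
      scalar integral is absolutely continuous.\<close>
    obtain f :: "'a \<Rightarrow>\<^sub>L real"
      where f: "norm f \<le> 1" "blinfun_apply f (W A' - z k) = norm (W A' - z k)"
      using norming_functional .
    define gap where "gap = norm (W A' - z k) - e / 2"
    have "gap > 0"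
      using A' by (simp add: gap_def)
    \<comment> \<open>Passing from \<open>A'\<close> to \<open>B\<close> changes the value of
      \<open>f\<close> on \<open>W\<close> by two such terms, hence by at most
      \<open>2 * gap / 3\<close>, which keeps it above the threshold.\<close>
    obtain d1 where d1: "d1 > 0"
      "\<And>B. B \<in> sets M \<Longrightarrow> measure M B \<le> d1 \<Longrightarrow> \<bar>blinfun_apply f (W B)\<bar> \<le> gap / 3"
      using integral_uniformly_small_on_small_sets[OF weakly_integrable[of f], of "gap / 3"] \<open>gap > 0\<close>
      by (auto simp: weak_integral fmeasurable_eq_sets)
    have split_W: "blinfun_apply f (W B) = blinfun_apply f (W (B - C)) + blinfun_apply f (W (B \<inter> C))"
      if "B \<in> sets M" "C \<in> sets M" for B C
    proof -
      have "(B - C) \<inter> (B \<inter> C) = {}" "(B - C) \<union> (B \<inter> C) = B"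
        by auto
      then show ?thesis
        using functional_W_Un[of "B - C" "B \<inter> C" f] that by simp
    qed
    have "close A' (min d1 (d / 2)) k"
      unfolding close_def
    proof (intro ballI impI)
      fix B assume B: "B \<in> sets M" "measure M (sym_diff B A') \<le> min d1 (d / 2)"
      have "measure M (B - A') \<le> measure M (sym_diff B A')"
        "measure M (A' - B) \<le> measure M (sym_diff B A')"
        using B(1) A'_sets by (auto intro: finite_measure_mono)
      then have "\<bar>blinfun_apply f (W (B - A'))\<bar> \<le> gap / 3" "\<bar>blinfun_apply f (W (A' - B))\<bar> \<le> gap / 3"
        using d1(2)[of "B - A'"] d1(2)[of "A' - B"] B A'_sets by auto
      moreover have "blinfun_apply f (W B) = blinfun_apply f (W (B - A')) + blinfun_apply f (W (B \<inter> A'))"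
        by (rule split_W[OF B(1) A'_sets])
      moreover have "blinfun_apply f (W A') = blinfun_apply f (W (A' - B)) + blinfun_apply f (W (B \<inter> A'))"
        using split_W[OF A'_sets B(1)] by (simp add: Int_commute)
      ultimately have "blinfun_apply f (W B - z k) > e / 2"
        using f(2) \<open>gap > 0\<close> unfolding gap_def blinfun.diff_right abs_le_iff
        by (simp add: field_simps)
      then show "norm (W B - z k) > e / 2"
        using blinfun_apply_le_norm[OF f(1), of "W B - z k"] by linarith
    qed
    then show ?thesis
      using A'_sets A'_near d1(1) \<open>d > 0\<close> by (intro exI[of _ A'] exI[of _ "min d1 (d / 2)"]) auto
  qed
  \<comment> \<open>A state is a centre with a radius; stage \<open>n\<close> at least halves the
    radius, moves the centre by at most half the old radius and avoids \<open>z n\<close>.\<close>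
  define Q where "Q n p q \<longleftrightarrow> snd q \<le> snd p / 2 \<and> measure M (sym_diff (fst q) (fst p)) \<le> snd p / 2
    \<and> close (fst q) (snd q) n" for n and p q :: "'b set \<times> real"
  have "\<exists>F. \<forall>n. (fst (F n) \<in> sets M \<and> snd (F n) > 0) \<and> Q n (F n) (F (Suc n))"
  proof (rule dependent_nat_choice)
    show "\<exists>p. fst p \<in> sets M \<and> snd p > (0::real)"
      by (intro exI[of _ "({}, 1)"]) auto
    show "\<exists>q. (fst q \<in> sets M \<and> snd q > 0) \<and> Q n p q"
      if "fst p \<in> sets M \<and> snd p > 0" for p n
      using step[of "fst p" "snd p" n] that unfolding Q_def by auto
  qed
  then obtain F where F: "\<And>n. fst (F n) \<in> sets M" "\<And>n. snd (F n) > 0" "\<And>n. Q n (F n) (F (Suc n))"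
    by blast
  define A where "A n = fst (F n)" for n
  define d where "d n = snd (F n)" for n
  have A: "A n \<in> sets M" and d_pos: "d n > 0" and d_Suc: "d (Suc n) \<le> d n / 2"
    and near: "measure M (sym_diff (A (Suc n)) (A n)) \<le> d n / 2"
    and far: "close (A (Suc n)) (d (Suc n)) n" for n
    using F[of n] by (auto simp: A_def d_def Q_def)
  \<comment> \<open>The lower limit of the centres serves as their limit in the metric, which makes
    completeness explicit.\<close>
  define L where "L = (\<Union>m. \<Inter>j\<in>{m..}. A j)"
  have L: "L \<in> sets M"
    unfolding L_def using A by (intro sets.countable_UN sets.countable_INT') auto
  have d_geo: "d (k + j) \<le> d k * (1 / 2) ^ j" for k j
  proof (induction j)
    case (Suc j)
    then show ?case
      using d_Suc[of "k + j"] by simp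
  qed simp
  have L_near: "measure M (sym_diff L (A k)) \<le> d k" for k
  proof -
    \<comment> \<open>A point outside all consecutive differences from \<open>k\<close> on belongs
      to all \<open>A i\<close> with \<open>i \<ge> k\<close> or to none, so these differences cover
      \<open>sym_diff L (A k)\<close>; their measures are dominated by a geometric series with sum
      \<open>d k\<close>.\<close>
    define D where "D j = sym_diff (A (Suc (k + j))) (A (k + j))" for j
    have D: "range D \<subseteq> sets M"
      using A by (auto simp: D_def)
    have D_le: "measure M (D j) \<le> d k / 2 * (1 / 2) ^ j" for j
      using near[of "k + j"] d_geo[of k j] by (simp add: D_def)
    have geo: "(\<lambda>j. d k / 2 * (1 / 2) ^ j) sums d k"
      using sums_mult[OF geometric_sums[of "1 / 2 :: real"], of "d k / 2"] by simp
    have summ: "summable (\<lambda>j. measure M (D j))"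
      by (rule summable_comparison_test'[OF sums_summable[OF geo], of 0]) (use D_le in auto)
    have "sym_diff L (A k) \<subseteq> (\<Union>j. D j)"
    proof
      fix x assume x: "x \<in> sym_diff L (A k)"
      show "x \<in> (\<Union>j. D j)"
      proof (rule ccontr)
        assume "x \<notin> (\<Union>j. D j)"
        then have "x \<in> A (Suc (k + j)) \<longleftrightarrow> x \<in> A (k + j)" for j
          by (auto simp: D_def)
        then have "x \<in> A (k + j) \<longleftrightarrow> x \<in> A k" for j
          by (induction j) auto
        then have same: "x \<in> A i \<longleftrightarrow> x \<in> A k" if "i \<ge> k" for i
          using that by (metis le_Suc_ex)
        have "x \<in> L \<longleftrightarrow> x \<in> A k"
        proof
          assume "x \<in> L"
          then obtain m where "\<forall>j\<ge>m. x \<in> A j"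
            by (auto simp: L_def)
          then have "x \<in> A (max m k)"
            by simp
          then show "x \<in> A k"
            using same[of "max m k"] by (simp only: max.cobounded2)
        next
          assume "x \<in> A k"
          then have "\<forall>i\<ge>k. x \<in> A i"
            using same by blast
          then show "x \<in> L"
            unfolding L_def by blast
        qed
        then show False
          using x by blast
      qed
    qed
    then have "measure M (sym_diff L (A k)) \<le> measure M (\<Union>j. D j)"
      using D by (intro finite_measure_mono) auto
    also have "\<dots> \<le> (\<Sum>j. measure M (D j))"
      by (rule finite_measure_subadditive_countably[OF D summ])
    also have "\<dots> \<le> (\<Sum>j. d k / 2 * (1 / 2) ^ j)"
      by (rule suminf_le[OF _ summ sums_summable[OF geo]]) (rule D_le)
    also have "\<dots> = d k"
      using geo by (rule sums_unique[symmetric])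
    finally show ?thesis .
  qed
  obtain k where "norm (W L - z k) < e / 2"
    using dense[of "e / 2" "W L"] \<open>e > 0\<close> by auto
  \<comment> \<open>The ball that avoids \<open>z k\<close> is the one with index
    \<open>Suc k\<close>, and \<open>L\<close> lies in it.\<close>
  moreover have "norm (W L - z k) > e / 2"
    using far[of k] L L_near[of "Suc k"] unfolding close_def by blast
  ultimately show False
    by simp
qed

end

section \<open>From the indefinite Pettis integral to the McShane integral\<close>

lemma (in finite_measure) set_integral_near_const:
  fixes g :: "'a \<Rightarrow> real"
  assumes "set_integrable M A g" "A \<in> sets M" "\<And>x. x \<in> A \<Longrightarrow> \<bar>g x - c\<bar> \<le> e"
  shows "\<bar>(LINT x:A|M. g x) - measure M A * c\<bar> \<le> e * measure M A"
proof -
  have const: "set_integrable M A (\<lambda>_. k)" "(LINT x:A|M. k) = measure M A * k" for k :: real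
    using assms(2) integrable_mult_indicator[OF assms(2) integrable_const[of k]]
    by (simp_all add: set_integral_const set_integrable_def)
  have "measure M A * (c - e) \<le> (LINT x:A|M. g x)"
    unfolding const(2)[symmetric]
  proof (rule set_integral_mono[OF const(1) assms(1)])
    show "c - e \<le> g x" if "x \<in> A" for x
      using assms(3)[OF that] by (simp add: abs_le_iff)
  qed
  moreover have "(LINT x:A|M. g x) \<le> measure M A * (c + e)"
    unfolding const(2)[symmetric]
  proof (rule set_integral_mono[OF assms(1) const(1)])
    show "g x \<le> c + e" if "x \<in> A" for x
      using assms(3)[OF that] by (simp add: abs_le_iff)
  qed
  ultimately show ?thesis
    by (simp add: abs_le_iff algebra_simps)
qed

text \<open>\<open>pettis_integrable\<close> integrates over the restricted space of each
  \<open>E\<close>, whereas the locale uses set integrals on one space; iterated restriction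
  identifies the two.\<close>

lemma has_bochner_integral_lebesgue_on_subset:
  fixes g :: "real \<Rightarrow> real"
  assumes "E \<in> sets (lebesgue_on S)" "S \<in> sets lebesgue"
  shows "has_bochner_integral (lebesgue_on E) g v \<longleftrightarrow>
    set_integrable (lebesgue_on S) E g \<and> (LINT x:E|lebesgue_on S. g x) = v"
proof -
  have E: "E \<subseteq> S"
    using sets.sets_into_space[OF assms(1)] by simp
  have "lebesgue_on E = restrict_space (lebesgue_on S) E"
    using E assms by (subst restrict_restrict_space) (auto simp: Int_absorb1 sets_restrict_space_iff)
  moreover have "E \<inter> space (lebesgue_on S) \<in> sets (lebesgue_on S)"
    using assms(1) by blast
  ultimately show ?thesis
    by (simp only: has_bochner_integral_iff integrable_restrict_space integral_restrict_space
        set_integrable_def set_lebesgue_integral_def)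
qed

lemma pettis_integrable_iff_indefinite:
  fixes \<phi> :: "real \<Rightarrow> 'a::banach"
  shows "pettis_integrable \<phi> \<longleftrightarrow> (\<exists>W. indefinite_pettis_integral (lebesgue_on {0..1}) \<phi> W)"
proof
  assume "pettis_integrable \<phi>"
  then obtain W where W: "\<And>E (f :: 'a \<Rightarrow>\<^sub>L real). E \<in> sets (lebesgue_on {0..1}) \<Longrightarrow>
      has_bochner_integral (lebesgue_on E) (\<lambda>x. blinfun_apply f (\<phi> x)) (blinfun_apply f (W E))"
    unfolding pettis_integrable_def by metis
  have "indefinite_pettis_integral (lebesgue_on {0..1}) \<phi> W"
  proof (intro indefinite_pettis_integral.intro indefinite_pettis_integral_axioms.intro)
    show "finite_measure (lebesgue_on {0..1::real})"
      by (intro finite_measure_lebesgue_on) simp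
    show "integrable (lebesgue_on {0..1}) (\<lambda>x. blinfun_apply f (\<phi> x))" for f :: "'a \<Rightarrow>\<^sub>L real"
      using W[of "{0..1}" f] by (auto simp: has_bochner_integral_iff)
    show "(LINT x:E|lebesgue_on {0..1}. blinfun_apply f (\<phi> x)) = blinfun_apply f (W E)"
      if "E \<in> sets (lebesgue_on {0..1})" for E and f :: "'a \<Rightarrow>\<^sub>L real"
      using W[OF that, of f] that by (simp add: has_bochner_integral_lebesgue_on_subset)
  qed
  then show "\<exists>W. indefinite_pettis_integral (lebesgue_on {0..1}) \<phi> W"
    by blast
next
  assume "\<exists>W. indefinite_pettis_integral (lebesgue_on {0..1}) \<phi> W"
  then obtain W where "indefinite_pettis_integral (lebesgue_on {0..1}) \<phi> W"
    by blast
  then interpret indefinite_pettis_integral "lebesgue_on {0..1}" \<phi> W .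
  show "pettis_integrable \<phi>"
    unfolding pettis_integrable_def
  proof
    fix E :: "real set" assume E: "E \<in> sets (lebesgue_on {0..1})"
    show "\<exists>w. \<forall>f :: 'a \<Rightarrow>\<^sub>L real.
        has_bochner_integral (lebesgue_on E) (\<lambda>x. blinfun_apply f (\<phi> x)) (blinfun_apply f w)"
      using E by (intro exI[of _ "W E"])
        (simp add: has_bochner_integral_lebesgue_on_subset set_integrable_functional weak_integral)
  qed
qed

text \<open>The delicate point is uniformity over partitions: the exceptional set \<open>R\<close>
  varies with the partition, so the gauge bounds its measure in advance by a \<open>d\<close> below
  which \<open>W\<close> is small on every measurable set.\<close>

lemma has_mcshane_integral_indefinite_pettis:
  fixes \<phi> :: "real \<Rightarrow> 'a::banach" and z :: "nat \<Rightarrow> 'a"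
  assumes pettis: "indefinite_pettis_integral (lebesgue_on {0..1}) \<phi> W"
    and dense: "\<And>x e. e > 0 \<Longrightarrow> \<exists>n. norm (x - z n) < e"
  shows "has_mcshane_integral \<phi> (W {0..1})"
  unfolding has_mcshane_integral_def
proof (intro allI impI)
  fix \<epsilon> :: real assume "\<epsilon> > 0"
  let ?M = "lebesgue_on {0..1::real}"
  interpret indefinite_pettis_integral ?M \<phi> W
    by (fact pettis)
  \<comment> \<open>The budget is \<open>2 * e\<close> for the variation of \<open>\<phi>\<close> on
    the sets \<open>E k\<close>, \<open>e\<close> for \<open>W R\<close> and \<open>e\<close> for
    the part of the Riemann sum carried by \<open>R\<close>.\<close>
  define e where "e = \<epsilon> / 4"
  have "e > 0"
    using \<open>\<epsilon> > 0\<close> by (simp add: e_def)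
  obtain d where "d > 0" and d: "\<And>R. R \<in> sets ?M \<Longrightarrow> measure ?M R \<le> d \<Longrightarrow> norm (W R) \<le> e"
    using W_uniformly_small_on_small_sets[OF dense \<open>e > 0\<close>] by metis
  have sets_M: "A \<in> sets ?M \<longleftrightarrow> A \<subseteq> {0..1} \<and> A \<in> sets lebesgue" for A
    by (simp add: sets_restrict_space_iff)
  define A where "A k = {x \<in> space ?M. norm (\<phi> x - z k) \<le> e}" for k
  have A: "A k \<in> sets ?M" for k
    unfolding A_def using weakly_integrable dense by (intro measurable_set_norm_le) auto
  \<comment> \<open>The least index makes the sets \<open>E k\<close> disjoint and presents each as
    \<open>A k\<close> minus finitely many earlier \<open>A j\<close>, hence measurable.\<close>
  define N where "N x = (LEAST n. norm (\<phi> x - z n) \<le> e)" for x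
  have "\<exists>n. norm (\<phi> x - z n) \<le> e" for x
    using dense[OF \<open>e > 0\<close>] less_imp_le by metis
  then have N: "norm (\<phi> x - z (N x)) \<le> e" for x
    unfolding N_def by (rule LeastI_ex)
  define E where "E k = {x \<in> {0..1}. N x = k}" for k
  have "E k = A k - (\<Union>j<k. A j)" for k
  proof -
    have "N x = k \<longleftrightarrow> norm (\<phi> x - z k) \<le> e \<and> (\<forall>j<k. \<not> norm (\<phi> x - z j) \<le> e)" for x
      using N[of x] not_less_Least[of _ "\<lambda>n. norm (\<phi> x - z n) \<le> e"] unfolding N_def
      by (metis linorder_neqE_nat)
    then show ?thesis
      by (auto simp: E_def A_def)
  qed
  then have E: "E k \<in> sets ?M" for k
    using A by auto
  \<comment> \<open>The excess allowed around \<open>E k\<close>. The geometric factor keeps the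
    total at most \<open>d\<close>, and the quotient keeps the total at most \<open>e\<close> after
    weighting with \<open>norm (z k) + e\<close>, which bounds \<open>\<phi>\<close> on
    \<open>E k\<close>.\<close>
  define c where "c k = min d (e / (norm (z k) + e)) * (1 / 2) ^ Suc k" for k
  have "c k > 0" for k
    using \<open>d > 0\<close> \<open>e > 0\<close> by (simp add: c_def add_nonneg_pos)
  then have "\<exists>G. open G \<and> E k \<subseteq> G \<and> G - E k \<in> lmeasurable \<and> measure lebesgue (G - E k) \<le> c k" for k
    using sets_lebesgue_outer_open[of "E k" "c k"] E[of k] unfolding sets_M
    by (metis emeasure_eq_measure2 ennreal_less_iff less_imp_le measure_nonneg)
  then obtain G where G: "\<And>k. open (G k)" "\<And>k. E k \<subseteq> G k" "\<And>k. G k - E k \<in> lmeasurable"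
    "\<And>k. measure lebesgue (G k - E k) \<le> c k"
    by metis
  \<comment> \<open>Closed balls, because subordination admits the end points
    \<open>t - \<delta> t\<close> and \<open>t + \<delta> t\<close>; off \<open>{0..1}\<close> the
    radius is a default.\<close>
  have "\<exists>r>0. t \<in> {0..1} \<longrightarrow> cball t r \<subseteq> G (N t)" for t
  proof (cases "t \<in> {0..1}")
    case True
    then have "t \<in> G (N t)"
      using G(2)[of "N t"] by (auto simp: E_def)
    then show ?thesis
      using G(1) open_contains_cball by blast
  qed (auto intro: exI[of _ 1])
  then obtain \<delta> where \<delta>: "\<And>t. \<delta> t > 0" "\<And>t. t \<in> {0..1} \<Longrightarrow> cball t (\<delta> t) \<subseteq> G (N t)"
    by metis
  have "norm (W {0..1} - (\<Sum>i<n. (b i - a i) *\<^sub>R \<phi> (t i))) \<le> \<epsilon>"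
    if part: "mcshane_partition n a b t" and sub: "mcshane_subordinate \<delta> n a b t" for n a b t
  proof -
    define m where "m i = N (t i)" for i
    \<comment> \<open>Non-overlapping closed intervals may share end points; their interiors are
      disjoint and have the same lengths.\<close>
    define J where "J i = {a i<..<b i}" for i
    have ab: "a i \<le> b i" and ab_sub: "{a i..b i} \<subseteq> {0..1}" and t: "t i \<in> {0..1}" if "i < n" for i
      using part that unfolding mcshane_partition_def by blast+
    have J_disj: "disjoint_family_on J {..<n}"
      using part unfolding mcshane_partition_def disjoint_family_on_def J_def
      by (simp add: interior_atLeastAtMost_real)
    have J_ab: "J i \<subseteq> {a i..b i}" for i
      by (auto simp: J_def)
    have J: "J i \<in> sets ?M" "measure ?M (J i) = b i - a i" "J i \<subseteq> G (m i)" if "i < n" for i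
    proof -
      have "J i \<subseteq> {0..1}"
        using J_ab ab_sub[OF that] by blast
      then show "J i \<in> sets ?M" "measure ?M (J i) = b i - a i"
        using ab[OF that] by (simp_all add: J_def sets_M measure_restrict_space)
      have "J i \<subseteq> cball (t i) (\<delta> (t i))"
        using sub that unfolding mcshane_subordinate_def J_def by (force simp: dist_real_def)
      then show "J i \<subseteq> G (m i)"
        using \<delta>(2)[OF t[OF that]] by (auto simp: m_def)
    qed
    \<comment> \<open>Intervals are grouped by \<open>k = m i\<close>: those tagged in
      \<open>E k\<close> lie in \<open>G k\<close>, so the parts by which they leave
      \<open>E k\<close> have total measure at most \<open>c k\<close>. This is used with weight 1
      for the measure of \<open>R\<close> and with weight \<open>norm (z k) + e\<close> for the
      Riemann sum on \<open>R\<close>.\<close>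
    have weighted: "(\<Sum>i<n. measure ?M (J i - E (m i)) * v (m i)) \<le> x"
      if v: "\<And>k. v k \<ge> 0" "\<And>k. c k * v k \<le> x * (1 / 2) ^ Suc k" for v x
    proof -
      have "(\<Sum>i<n. measure ?M (J i - E (m i)) * v (m i))
          = (\<Sum>k\<in>m ` {..<n}. \<Sum>i\<in>{i \<in> {..<n}. m i = k}. measure ?M (J i - E (m i)) * v (m i))"
        by (rule sum.image_gen) simp
      also have "\<dots> \<le> (\<Sum>k\<in>m ` {..<n}. x * (1 / 2) ^ Suc k)"
      proof (rule sum_mono)
        fix k
        let ?S = "{i \<in> {..<n}. m i = k}"
        have "disjoint_family_on (\<lambda>i. J i - E k) ?S"
          using J_disj unfolding disjoint_family_on_def by blast
        then have "(\<Sum>i\<in>?S. measure ?M (J i - E k)) = measure ?M (\<Union>i\<in>?S. J i - E k)"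
          using J(1) E by (intro finite_measure_finite_Union[symmetric]) auto
        also have "\<dots> = measure lebesgue (\<Union>i\<in>?S. J i - E k)"
          using J(1) by (intro measure_restrict_space) (auto simp: sets_M)
        also have "\<dots> \<le> measure lebesgue (G k - E k)"
        proof (rule measure_mono_fmeasurable)
          show "(\<Union>i\<in>?S. J i - E k) \<subseteq> G k - E k"
            using J(3) by auto
          have "(\<Union>i\<in>?S. J i - E k) \<in> sets ?M"
            using J(1) E by (intro sets.finite_UN) auto
          then show "(\<Union>i\<in>?S. J i - E k) \<in> sets lebesgue"
            by (simp only: sets_M)
        qed (rule G(3))
        also have "\<dots> \<le> c k"
          by (rule G(4))
        finally have "(\<Sum>i\<in>?S. measure ?M (J i - E k)) * v k \<le> c k * v k"
          using v(1) by (rule mult_right_mono)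
        moreover have "(\<Sum>i\<in>?S. measure ?M (J i - E (m i)) * v (m i))
            = (\<Sum>i\<in>?S. measure ?M (J i - E k)) * v k"
          by (simp add: sum_distrib_right)
        ultimately show "(\<Sum>i\<in>?S. measure ?M (J i - E (m i)) * v (m i)) \<le> x * (1 / 2) ^ Suc k"
          using v(2)[of k] by linarith
      qed
      also have "\<dots> \<le> (\<Sum>k. x * (1 / 2) ^ Suc k)"
      proof (rule sum_le_suminf)
        show "summable (\<lambda>k. x * (1 / 2) ^ Suc k)"
          using power_half_series by (intro summable_mult sums_summable)
        show "0 \<le> x * (1 / 2) ^ Suc k" for k
          using v(1)[of k] v(2)[of k] \<open>c k > 0\<close> by (metis mult_nonneg_nonneg less_imp_le order_trans)
      qed simp
      also have "\<dots> = x"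
        using sums_mult[OF power_half_series, of x] by (simp add: sums_unique[symmetric])
      finally show ?thesis .
    qed
    define R where "R = (\<Union>i<n. J i - E (m i))"
    have JE_sets: "J i - E (m i) \<in> sets ?M" "J i \<inter> E (m i) \<in> sets ?M" if "i < n" for i
      using J(1)[OF that] E by auto
    have R: "R \<in> sets ?M"
      unfolding R_def using JE_sets by (intro sets.finite_UN) auto
    have "measure ?M R \<le> (\<Sum>i<n. measure ?M (J i - E (m i)) * 1)"
      unfolding R_def mult_1_right
      using JE_sets by (intro finite_measure_subadditive_finite) auto
    also have "\<dots> \<le> d"
      by (rule weighted) (auto simp: c_def intro!: mult_right_mono)
    finally have WR: "norm (W R) \<le> e"
      using d R by blast
    have v: "(\<Sum>i<n. measure ?M (J i - E (m i)) * (norm (z (m i)) + e)) \<le> e"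
    proof (rule weighted)
      show "c k * (norm (z k) + e) \<le> e * (1 / 2) ^ Suc k" for k
      proof -
        have "norm (z k) + e > 0"
          using \<open>e > 0\<close> by (simp add: add_nonneg_pos)
        then have "min d (e / (norm (z k) + e)) * (norm (z k) + e) \<le> e"
          by (metis min.cobounded2 pos_le_divide_eq)
        then have "min d (e / (norm (z k) + e)) * (norm (z k) + e) * (1 / 2) ^ Suc k \<le> e * (1 / 2) ^ Suc k"
          by (rule mult_right_mono) simp
        then show ?thesis
          unfolding c_def by (simp only: ac_simps)
      qed
    qed (use \<open>e > 0\<close> in simp)
    have J_total: "(\<Sum>i<n. measure ?M (J i)) \<le> 1"
    proof -
      have "(\<Sum>i<n. measure ?M (J i)) = measure ?M (\<Union>i<n. J i)"
        using J(1) J_disj by (intro finite_measure_finite_Union[symmetric]) auto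
      also have "\<dots> \<le> measure ?M (space ?M)"
        by (rule bounded_measure)
      finally show ?thesis
        by (simp add: measure_restrict_space)
    qed
    show ?thesis
    proof (rule norm_le_if_functionals_le)
      fix f :: "'a \<Rightarrow>\<^sub>L real" assume f: "norm f \<le> 1"
      define g where "g x = blinfun_apply f (\<phi> x)" for x
      have g_int: "set_integrable ?M B g" if "B \<in> sets ?M" for B
        unfolding g_def by (rule set_integrable_functional[OF that])
      have "blinfun_apply f (W {0..1}) = (LINT x:{0..1}|?M. g x)"
        unfolding g_def by (rule weak_integral[symmetric]) simp
      \<comment> \<open>Passing to the open intervals discards only end points, a finite null
        set.\<close>
      also have "\<dots> = (LINT x:(\<Union>i<n. J i)|?M. g x)"
      proof (rule set_integral_discrete_difference)
        let ?X = "a ` {..<n} \<union> b ` {..<n}"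
        show "countable ?X"
          by (intro countable_finite) simp
        have cover: "{0..1} = (\<Union>i<n. {a i..b i})"
          using part by (simp add: mcshane_partition_def)
        show "({0..1} - (\<Union>i<n. J i)) \<union> ((\<Union>i<n. J i) - {0..1}) \<subseteq> ?X"
        proof -
          have "x \<in> J i \<union> {a i, b i}" if "x \<in> {a i..b i}" for x i
            using that by (auto simp: J_def)
          then have "{0..1} - (\<Union>i<n. J i) \<subseteq> ?X"
            unfolding cover by fast
          moreover have "(\<Union>i<n. J i) - {0..1} = {}"
            unfolding cover using J_ab by fast
          ultimately show ?thesis
            by (simp only: Un_empty_right)
        qed
        show "emeasure ?M {x} = 0" "{x} \<in> sets ?M" if "x \<in> ?X" for x
        proof -
          have "x \<in> {0..1}"
            using that ab ab_sub by fastforce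
          then show "emeasure ?M {x} = 0" "{x} \<in> sets ?M"
            by (auto simp: emeasure_restrict_space sets_M)
        qed
      qed
      also have "\<dots> = (\<Sum>i<n. LINT x:J i|?M. g x)"
        using J(1) J_disj g_int by (intro set_integral_finite_Union) auto
      also have "\<dots> = (\<Sum>i<n. (LINT x:J i \<inter> E (m i)|?M. g x) + (LINT x:J i - E (m i)|?M. g x))"
      proof (rule sum.cong)
        fix i assume "i \<in> {..<n}"
        moreover have "J i = (J i \<inter> E (m i)) \<union> (J i - E (m i))"
          by auto
        ultimately show "(LINT x:J i|?M. g x)
            = (LINT x:J i \<inter> E (m i)|?M. g x) + (LINT x:J i - E (m i)|?M. g x)"
          using set_integral_Un[of "J i \<inter> E (m i)" "J i - E (m i)" ?M g] JE_sets g_int by auto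
      qed simp
      also have "\<dots> = (\<Sum>i<n. LINT x:J i \<inter> E (m i)|?M. g x) + blinfun_apply f (W R)"
      proof -
        have "disjoint_family_on (\<lambda>i. J i - E (m i)) {..<n}"
          using J_disj unfolding disjoint_family_on_def by blast
        then have "(\<Sum>i<n. LINT x:J i - E (m i)|?M. g x) = (LINT x:R|?M. g x)"
          unfolding R_def using JE_sets g_int by (intro set_integral_finite_Union[symmetric]) auto
        also have "\<dots> = blinfun_apply f (W R)"
          unfolding g_def by (rule weak_integral[OF R])
        finally show ?thesis
          by (simp add: sum.distrib)
      qed
      finally have fW: "blinfun_apply f (W {0..1})
        = (\<Sum>i<n. LINT x:J i \<inter> E (m i)|?M. g x) + blinfun_apply f (W R)" .
      have "(b i - a i) * g (t i)
          = measure ?M (J i \<inter> E (m i)) * g (t i) + measure ?M (J i - E (m i)) * g (t i)"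
        if "i < n" for i
      proof -
        have "b i - a i = measure ?M (J i \<inter> E (m i)) + measure ?M (J i - E (m i))"
          using finite_measure_Diff'[of "J i" "E (m i)"] J(1,2)[OF that] E[of "m i"] by simp
        then show ?thesis
          by (simp only: distrib_right)
      qed
      then have "blinfun_apply f (\<Sum>i<n. (b i - a i) *\<^sub>R \<phi> (t i))
          = (\<Sum>i<n. measure ?M (J i \<inter> E (m i)) * g (t i)) + (\<Sum>i<n. measure ?M (J i - E (m i)) * g (t i))"
        by (simp add: blinfun.sum_right blinfun.scaleR_right g_def flip: sum.distrib)
      then have diff: "blinfun_apply f (W {0..1} - (\<Sum>i<n. (b i - a i) *\<^sub>R \<phi> (t i)))
          = (\<Sum>i<n. (LINT x:J i \<inter> E (m i)|?M. g x) - measure ?M (J i \<inter> E (m i)) * g (t i))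
            + blinfun_apply f (W R) - (\<Sum>i<n. measure ?M (J i - E (m i)) * g (t i))"
        by (simp add: blinfun.diff_right fW sum_subtractf)
      have "\<bar>\<Sum>i<n. (LINT x:J i \<inter> E (m i)|?M. g x) - measure ?M (J i \<inter> E (m i)) * g (t i)\<bar>
          \<le> (\<Sum>i<n. 2 * e * measure ?M (J i))"
      proof (rule order_trans[OF sum_abs sum_mono])
        fix i assume "i \<in> {..<n}"
        then have i: "i < n"
          by simp
        \<comment> \<open>Both \<open>\<phi> x\<close> and \<open>\<phi> (t i)\<close> lie within
          \<open>e\<close> of the same \<open>z (m i)\<close>.\<close>
        have "\<bar>g x - g (t i)\<bar> \<le> 2 * e" if "x \<in> J i \<inter> E (m i)" for x
        proof -
          have "N x = N (t i)"
            using that by (simp add: E_def m_def)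
          then have "norm (\<phi> x - \<phi> (t i)) \<le> e + e"
            using norm_triangle_le_diff[of "\<phi> x - z (N x)" "\<phi> (t i) - z (N x)"] N[of x] N[of "t i"]
            by simp
          then show ?thesis
            using blinfun_apply_le_norm[OF f, of "\<phi> x - \<phi> (t i)"]
            by (simp add: g_def blinfun.diff_right)
        qed
        then have "\<bar>(LINT x:J i \<inter> E (m i)|?M. g x) - measure ?M (J i \<inter> E (m i)) * g (t i)\<bar>
            \<le> 2 * e * measure ?M (J i \<inter> E (m i))"
          using JE_sets[OF i] g_int by (intro set_integral_near_const) auto
        also have "\<dots> \<le> 2 * e * measure ?M (J i)"
          using \<open>e > 0\<close> J(1)[OF i] by (intro mult_left_mono finite_measure_mono) auto
        finally show "\<bar>(LINT x:J i \<inter> E (m i)|?M. g x) - measure ?M (J i \<inter> E (m i)) * g (t i)\<bar>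
            \<le> 2 * e * measure ?M (J i)" .
      qed
      also have "\<dots> \<le> 2 * e"
        using J_total \<open>e > 0\<close> by (simp flip: sum_distrib_left)
      finally have 1: "\<bar>\<Sum>i<n. (LINT x:J i \<inter> E (m i)|?M. g x) - measure ?M (J i \<inter> E (m i)) * g (t i)\<bar>
          \<le> 2 * e" .
      have 2: "\<bar>blinfun_apply f (W R)\<bar> \<le> e"
        using blinfun_apply_le_norm[OF f, of "W R"] WR by linarith
      have "\<bar>\<Sum>i<n. measure ?M (J i - E (m i)) * g (t i)\<bar>
          \<le> (\<Sum>i<n. measure ?M (J i - E (m i)) * (norm (z (m i)) + e))"
      proof (rule order_trans[OF sum_abs sum_mono])
        fix i
        have "\<bar>g (t i)\<bar> \<le> norm (\<phi> (t i))"
          unfolding g_def by (rule blinfun_apply_le_norm[OF f])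
        also have "\<dots> \<le> norm (z (m i)) + e"
          using norm_triangle_sub[of "\<phi> (t i)" "z (m i)"] N[of "t i"] by (simp add: m_def)
        finally show "\<bar>measure ?M (J i - E (m i)) * g (t i)\<bar>
            \<le> measure ?M (J i - E (m i)) * (norm (z (m i)) + e)"
          by (simp add: abs_mult mult_left_mono)
      qed
      then have 3: "\<bar>\<Sum>i<n. measure ?M (J i - E (m i)) * g (t i)\<bar> \<le> e"
        using v by linarith
      show "\<bar>blinfun_apply f (W {0..1} - (\<Sum>i<n. (b i - a i) *\<^sub>R \<phi> (t i)))\<bar> \<le> \<epsilon>"
        using 1 2 3 unfolding diff e_def by linarith
    qed
  qed
  moreover have "mcshane_gauge \<delta>"
    using \<delta>(1) by (simp add: mcshane_gauge_def)
  ultimately show "\<exists>\<delta>. mcshane_gauge \<delta> \<and> (\<forall>n a b t. mcshane_partition n a b t \<longrightarrow>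
      mcshane_subordinate \<delta> n a b t \<longrightarrow> norm (W {0..1} - (\<Sum>i<n. (b i - a i) *\<^sub>R \<phi> (t i))) \<le> \<epsilon>)"
    by blast
qed

section \<open>McShane integrability versus Pettis integrability\<close>

lemma mcshane_partition_exists:
  assumes "mcshane_gauge \<delta>"
  shows "\<exists>n a b t. mcshane_partition n a b t \<and> mcshane_subordinate \<delta> n a b t"
proof (rule ccontr)
  \<comment> \<open>Otherwise every number is vacuously close to all McShane sums of the zero function.\<close>
  assume none: "\<not> ?thesis"
  obtain p where p: "p tagged_division_of {0..1::real}"
    "(\<lambda>x. ball x (if x \<in> {0..1} then \<delta> x else 1)) fine p"
    using fine_division_exists_real[OF gauge_ball_if_mcshane_gauge[OF assms]] .
  note p' = tagged_division_ofD[OF p(1)]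
  have "norm (1 - (\<Sum>q\<in>p. measure lborel (snd q) *\<^sub>R (0 :: real))) \<le> 0"
  proof (rule mcshane_bound_indexed[where \<delta> = \<delta> and t = fst])
    show "(\<Union>q\<in>p. snd q) = {0..1}"
      using p'(6) by force
    show "\<exists>u v. snd q = {u..v}" if "q \<in> p" for q
      using p'(4)[of "fst q" "snd q"] that by auto
    show "interior (snd q) \<inter> interior (snd r) = {}" if "q \<in> p" "r \<in> p" "q \<noteq> r" for q r
      using p'(5)[of "fst q" "snd q" "fst r" "snd r"] that by simp
    show tag: "fst q \<in> {0..1}" if "q \<in> p" for q
      using p'(2,3)[of "fst q" "snd q"] that by auto
    show "snd q \<subseteq> {fst q - \<delta> (fst q)..fst q + \<delta> (fst q)}" if "q \<in> p" for q
      using ball_fine_subset[OF p(2), of "fst q" "snd q"] tag[OF that] that by simp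
  qed (use p' none in auto)
  then show False
    by simp
qed

text \<open>For each tolerance \<open>r k\<close> one subordinate partition is fixed, and it serves
  all functionals and all \<open>E\<close> at once. The scalar estimates are thus uniform over the
  dual unit ball and become norm estimates, so completeness supplies the vectors
  \<open>W E\<close>.\<close>

lemma pettis_integrable_if_mcshane_integrable:
  fixes \<phi> :: "real \<Rightarrow> 'a::banach"
  assumes "mcshane_integrable \<phi>"
  shows "pettis_integrable \<phi>"
proof -
  let ?M = "lebesgue_on {0..1::real}"
  obtain w where w: "has_mcshane_integral \<phi> w"
    using assms by (auto simp: mcshane_integrable_def)
  \<comment> \<open>A gauge for \<open>\<phi>\<close> serves every functional, with the tolerance
    scaled by \<open>norm f\<close>.\<close>
  have scalar: "norm (blinfun_apply f w - (\<Sum>i<n. (b i - a i) *\<^sub>R blinfun_apply f (\<phi> (t i)))) \<le> norm f * e"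
    if "norm (w - (\<Sum>i<n. (b i - a i) *\<^sub>R \<phi> (t i))) \<le> e"
    for f :: "'a \<Rightarrow>\<^sub>L real" and n a b t e
  proof -
    have "blinfun_apply f w - (\<Sum>i<n. (b i - a i) *\<^sub>R blinfun_apply f (\<phi> (t i)))
        = blinfun_apply f (w - (\<Sum>i<n. (b i - a i) *\<^sub>R \<phi> (t i)))"
      by (simp add: blinfun.diff_right blinfun.sum_right blinfun.scaleR_right)
    also have "norm \<dots> \<le> norm f * norm (w - (\<Sum>i<n. (b i - a i) *\<^sub>R \<phi> (t i)))"
      by (rule norm_blinfun)
    also have "\<dots> \<le> norm f * e"
      using that by (rule mult_left_mono) simp
    finally show ?thesis .
  qed
  have fw: "((\<lambda>x. blinfun_apply f (\<phi> x)) has_integral blinfun_apply f w) {0..1}" for f :: "'a \<Rightarrow>\<^sub>L real"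
  proof (rule has_integral_if_has_mcshane_integral, unfold has_mcshane_integral_def, intro allI impI)
    fix e :: real assume "e > 0"
    \<comment> \<open>The added 1 covers \<open>f = 0\<close>.\<close>
    then have "e / (norm f + 1) > 0"
      by (simp add: add_nonneg_pos)
    then obtain \<delta> where \<delta>: "mcshane_gauge \<delta>"
      "\<And>n a b t. mcshane_partition n a b t \<Longrightarrow> mcshane_subordinate \<delta> n a b t \<Longrightarrow>
        norm (w - (\<Sum>i<n. (b i - a i) *\<^sub>R \<phi> (t i))) \<le> e / (norm f + 1)"
      using w unfolding has_mcshane_integral_def by meson
    have "norm f * (e / (norm f + 1)) \<le> (norm f + 1) * (e / (norm f + 1))"
      using \<open>e / (norm f + 1) > 0\<close> by (intro mult_right_mono) auto
    also have "\<dots> = e"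
      using norm_ge_zero[of f] by (simp add: add_nonneg_eq_0_iff)
    finally have "norm f * (e / (norm f + 1)) \<le> e" .
    then show "\<exists>\<delta>. mcshane_gauge \<delta> \<and> (\<forall>n a b t. mcshane_partition n a b t \<longrightarrow>
        mcshane_subordinate \<delta> n a b t \<longrightarrow>
        norm (blinfun_apply f w - (\<Sum>i<n. (b i - a i) *\<^sub>R blinfun_apply f (\<phi> (t i)))) \<le> e)"
      using \<delta> scalar order_trans by blast
  qed
  define r where "r k = inverse (real (Suc k))" for k
  have "\<exists>\<delta>. mcshane_gauge \<delta> \<and> (\<forall>n a b t. mcshane_partition n a b t \<longrightarrow>
      mcshane_subordinate \<delta> n a b t \<longrightarrow> norm (w - (\<Sum>i<n. (b i - a i) *\<^sub>R \<phi> (t i))) \<le> r k)" for k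
    using w unfolding has_mcshane_integral_def r_def by simp
  then obtain \<delta> where \<delta>: "\<And>k. mcshane_gauge (\<delta> k)"
    "\<And>k n a b t. mcshane_partition n a b t \<Longrightarrow> mcshane_subordinate (\<delta> k) n a b t \<Longrightarrow>
      norm (w - (\<Sum>i<n. (b i - a i) *\<^sub>R \<phi> (t i))) \<le> r k"
    by metis
  have "\<exists>n a b t. mcshane_partition n a b t \<and> mcshane_subordinate (\<delta> k) n a b t" for k
    using mcshane_partition_exists[OF \<delta>(1)] .
  then obtain n a b t where P: "\<And>k. mcshane_partition (n k) (a k) (b k) (t k)"
    "\<And>k. mcshane_subordinate (\<delta> k) (n k) (a k) (b k) (t k)"
    by metis
  define V where "V E k = (\<Sum>i<n k. measure lebesgue (E \<inter> {a k i..b k i}) *\<^sub>R \<phi> (t k i))" for E k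
  have int: "integrable ?M (\<lambda>x. blinfun_apply f (\<phi> x))" for f :: "'a \<Rightarrow>\<^sub>L real"
    using mcshane_scalar_estimate(1)[OF fw \<delta>(1) scalar[OF \<delta>(2)] P] .
  have est: "\<bar>(LINT x:E|?M. blinfun_apply f (\<phi> x)) - blinfun_apply f (V E k)\<bar> \<le> 2 * (norm f * r k)"
    if "E \<in> sets ?M" for E k and f :: "'a \<Rightarrow>\<^sub>L real"
    using mcshane_scalar_estimate(2)[OF fw \<delta>(1) scalar[OF \<delta>(2)] P that]
    by (simp add: V_def blinfun.sum_right blinfun.scaleR_right)
  have r_lim: "r \<longlonglongrightarrow> 0"
    unfolding r_def by (rule LIMSEQ_inverse_real_of_nat)
  have "Cauchy (V E)" if E: "E \<in> sets ?M" for E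
  proof (rule CauchyI)
    fix e :: real assume "e > 0"
    then obtain K where K: "\<And>k. k \<ge> K \<Longrightarrow> r k < e / 4"
      using order_tendstoD(2)[OF r_lim, of "e / 4"] by (auto simp: eventually_sequentially)
    have "norm (V E k - V E l) < e" if "k \<ge> K" "l \<ge> K" for k l
    proof -
      \<comment> \<open>Each functional compares both sums with the same scalar integral over
        \<open>E\<close>, and the resulting bound is free of \<open>f\<close>.\<close>
      have "norm (V E k - V E l) \<le> 2 * r k + 2 * r l"
      proof (rule norm_le_if_functionals_le)
        fix f :: "'a \<Rightarrow>\<^sub>L real" assume f: "norm f \<le> 1"
        have "norm f * r j \<le> r j" for j
          using mult_right_mono[OF f, of "r j"] by (simp add: r_def)
        then show "\<bar>blinfun_apply f (V E k - V E l)\<bar> \<le> 2 * r k + 2 * r l"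
          using est[OF E, of f k] est[OF E, of f l] unfolding blinfun.diff_right by (smt (verit))
      qed
      then show ?thesis
        using K[OF that(1)] K[OF that(2)] by simp
    qed
    then show "\<exists>K. \<forall>k\<ge>K. \<forall>l\<ge>K. norm (V E k - V E l) < e"
      by blast
  qed
  then have "\<exists>v. V E \<longlonglongrightarrow> v" if "E \<in> sets ?M" for E
    using that by (simp add: Cauchy_convergent_iff convergent_def)
  then obtain W where W: "\<And>E. E \<in> sets ?M \<Longrightarrow> V E \<longlonglongrightarrow> W E"
    by metis
  have "(LINT x:E|?M. blinfun_apply f (\<phi> x)) = blinfun_apply f (W E)"
    if E: "E \<in> sets ?M" for E and f :: "'a \<Rightarrow>\<^sub>L real"
  proof (rule LIMSEQ_unique)
    show "(\<lambda>k. blinfun_apply f (V E k)) \<longlonglongrightarrow> blinfun_apply f (W E)"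
      by (intro tendsto_intros W E)
    have "(\<lambda>k. 2 * (norm f * r k)) \<longlonglongrightarrow> 0"
      using tendsto_mult_left[OF r_lim, of "2 * norm f"] by (simp add: mult.assoc)
    then have "(\<lambda>k. blinfun_apply f (V E k) - (LINT x:E|?M. blinfun_apply f (\<phi> x))) \<longlonglongrightarrow> 0"
      by (rule Lim_null_comparison[rotated]) (use est[OF E, of f] in \<open>simp add: abs_minus_commute\<close>)
    then show "(\<lambda>k. blinfun_apply f (V E k)) \<longlonglongrightarrow> (LINT x:E|?M. blinfun_apply f (\<phi> x))"
      by (simp only: LIM_zero_iff)
  qed
  then have "indefinite_pettis_integral ?M \<phi> W"
    by (intro indefinite_pettis_integral.intro indefinite_pettis_integral_axioms.intro
        finite_measure_lebesgue_on int) auto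
  then show ?thesis
    unfolding pettis_integrable_iff_indefinite by blast
qed

lemma separable_space_dense_sequence:
  assumes "separable_space (euclidean :: 'a::real_normed_vector topology)"
  obtains z :: "nat \<Rightarrow> 'a::real_normed_vector" where "\<And>x e. e > 0 \<Longrightarrow> \<exists>n. norm (x - z n) < e"
proof -
  obtain C :: "'a set" where C: "countable C" "closure C = UNIV"
    using assms by (auto simp: separable_space_def)
  then have "C \<noteq> {}"
    by auto
  then have "range (from_nat_into C) = C"
    using C(1) by (rule range_from_nat_into)
  then have "\<exists>n. norm (x - from_nat_into C n) < e" if "e > 0" for x e
    using C(2) closure_approachable[of x C] that by (metis UNIV_I dist_commute dist_norm imageE)
  then show thesis
    by (rule that)
qed

theorem mainTheorem2:
  fixes \<phi> :: "real \<Rightarrow> 'a::banach"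
  assumes "separable_space (euclidean :: 'a topology)"
  shows "mcshane_integrable \<phi> \<longleftrightarrow> pettis_integrable \<phi>"
proof
  assume "pettis_integrable \<phi>"
  then obtain W where "indefinite_pettis_integral (lebesgue_on {0..1}) \<phi> W"
    by (auto simp: pettis_integrable_iff_indefinite)
  moreover obtain z :: "nat \<Rightarrow> 'a" where "\<And>x e. e > 0 \<Longrightarrow> \<exists>n. norm (x - z n) < e"
    using separable_space_dense_sequence[OF assms] by blast
  ultimately show "mcshane_integrable \<phi>"
    using has_mcshane_integral_indefinite_pettis unfolding mcshane_integrable_def by blast
qed (rule pettis_integrable_if_mcshane_integrable)

end
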